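(* Let $A \subset \mathbb{H}$ be a hull, and for $y > 0$ let $B_y = T_y(A) \subset \mathbb{D}$, where $T_y(z) = \frac{z - iy}{z + iy}$. Then \[ \lim_{y \to \infty} \frac{y^2 \operatorname{dcap}(B_y)}{\operatorname{hcap}(A)} = 2 . \] In other words, $\operatorname{dcap}(B_y) \sim \frac{2}{y^2} \operatorname{hcap}(A)$ as $y \to \infty$, where $a \sim b$ means $\frac{a}{b} \to 1$.
   Context: $\mathbb{H} = \{ z \in \mathbb{C} : \operatorname{Im} z > 0\}$ is the upper half-plane and $\mathbb{D} = \{ z \in \mathbb{C} : |z| < 1 \}$ the open unit disk; $T_y$ maps $\mathbb{H}$ conformally onto $\mathbb{D}$ with $T_y(iy) = 0$. A bounded subset $A \subset \mathbb{H}$ is called a hull if $\mathbb{H} \setminus A$ is a simply connected region (region = nonempty connected open set). The half-plane capacity of a hull $A$ is \[ \operatorname{hcap}(A) := \lim_{z \to \infty} z\,[g_A(z) - z], \] where $g_A : \mathbb{H} \setminus A \to \mathbb{H}$ is the unique conformal map (biholomorphism) with the hydrodynamic normalization $g_A(z) = z + O(1/z)$ as $z \to \infty$. For a simply connected domain $D \subsetneq \mathbb{C}$ and $z \in D$, the conformal radius is $\operatorname{crad}(D,z) := |f'(0)|$, where $f : \mathbb{D} \to D$ is a conformal map of $\mathbb{D}$ onto $D$ with $f(0) = z$. For $B \subset \mathbb{D}$ with $0 \notin B$ and $\mathbb{D} \setminus B$ a simply connected domain, \[ \operatorname{dcap}(B) := - \log \operatorname{crad}(\mathbb{D} \setminus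 B, 0). \] Since $A$ is bounded, $0 \notin B_y$ for all sufficiently large $y$, so $\operatorname{dcap}(B_y)$ is defined for all such $y$. *)

theory Defs
  imports "HOL-Complex_Analysis.Complex_Analysis" "HOL-Library.Landau_Symbols"
begin

definition upper_half_plane :: "complex set" ("\<H>") where
  "\<H> = {z. Im z > 0}"

abbreviation unit_disk :: "complex set" ("\<D>") where
  "\<D> \<equiv> ball 0 1"

definition conformal_onto :: "(complex \<Rightarrow> complex) \<Rightarrow> complex set \<Rightarrow> complex set \<Rightarrow> bool" where
  "conformal_onto f D E \<longleftrightarrow>
     f holomorphic_on D \<and> bij_betw f D E \<and> inv_into D f holomorphic_on E"

definition region :: "complex set \<Rightarrow> bool" where
  "region D \<longleftrightarrow> D \<noteq> {} \<and> open D \<and> connected D"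

(* Openness of the complement makes a hull relatively closed in the half-plane.
   The empty set is a hull. *)
definition half_plane_hull :: "complex set \<Rightarrow> bool" where
  "half_plane_hull A \<longleftrightarrow>
     A \<subseteq> \<H> \<and> bounded A \<and> region (\<H> - A) \<and> simply_connected (\<H> - A)"

(* The filter of z tending to infinity inside the domain of the mapping-out function. *)
definition hull_at_infinity :: "complex set \<Rightarrow> complex filter" where
  "hull_at_infinity A = inf at_infinity (principal (\<H> - A))"

definition hydrodynamic_map :: "complex set \<Rightarrow> (complex \<Rightarrow> complex) \<Rightarrow> bool" where
  "hydrodynamic_map A g \<longleftrightarrow>
     conformal_onto g (\<H> - A) \<H> \<and>
     (\<lambda>z. g z - z) \<in> O[hull_at_infinity A](\<lambda>z. 1 / z)"

(* Uniqueness determines this function only on the complement of A in the half-plane, so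
   a choice operator is used instead of a definite description; the values elsewhere are
   arbitrary and play no role. *)
definition mapping_out :: "complex set \<Rightarrow> complex \<Rightarrow> complex" where
  "mapping_out A = (SOME g. hydrodynamic_map A g)"

(* The limit of the complex quantity is a real number. *)
definition hcap :: "complex set \<Rightarrow> real" where
  "hcap A = (THE c. ((\<lambda>z. z * (mapping_out A z - z)) \<longlongrightarrow> complex_of_real c)
                      (hull_at_infinity A))"

(* The map f is unique up to a rotation of the disk, so the modulus of its derivative
   at 0 is well defined. *)
definition crad :: "complex set \<Rightarrow> complex \<Rightarrow> real" where
  "crad D z = (THE r. \<exists>f. conformal_onto f \<D> D \<and> f 0 = z \<and> r = cmod (deriv f 0))"

definition dcap :: "complex set \<Rightarrow> real" where
  "dcap B = - ln (crad (\<D> - B) 0)"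

definition cayley :: "real \<Rightarrow> complex \<Rightarrow> complex" where
  "cayley y z = (z - \<i> * of_real y) / (z + \<i> * of_real y)"

end

theory Submission
  imports Defs "HOL-Real_Asymp.Real_Asymp"
begin

text \<open>The whole argument rests on the expansion \<open>g z = z - k (- 1 / z)\<close> of the mapping-out
  function, with \<open>k\<close> holomorphic at \<open>0\<close> and \<open>k 0 = 0\<close>. To get it, take a Riemann map of the
  complement of the hull onto the disk and read its logarithm in the coordinate \<open>w = - 1 / z\<close>.
  The imaginary part tends to \<open>0\<close> at the real axis near \<open>w = 0\<close>; comparison with a quadratic
  harmonic barrier makes it vanish linearly there, so the derivative is bounded, the function
  extends continuously, and Schwarz reflection applies. A Moebius map sending the value at
  infinity back to infinity then produces a hydrodynamically normalized map.

  The maximum principle gives uniqueness of that map and \<open>Im (z - g z) \<ge> 0\<close>, and the leading term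
  of \<open>k\<close> at the boundary point \<open>0\<close> then forces \<open>hcap A = k'(0) > 0\<close>. Finally
  \<open>crad (\<D> - B y) 0 = Im (g (\<i> y)) / (y |g'(\<i> y)|)\<close>, where the numerator and the derivative each
  contribute \<open>hcap A / y\<^sup>2\<close> to the negative logarithm.\<close>

subsection \<open>Conformal maps and the maximum principle\<close>

text \<open>The boundary of a hull can be arbitrarily wild, so no map here is known to extend
  continuously to it. What replaces boundary values is properness: a conformal map pulls compact
  sets back to compact sets, and boundary behaviour is phrased as an estimate off a compact set. On
  the real axis away from the hull this makes an imaginary part small but says nothing about the
  real part, so reflection cannot be applied at once. The coordinate - 1 / z is chosen because it
  preserves the half-plane and moves infinity to an ordinary boundary point. Uniqueness is essential
  because \<open>mapping_out\<close> is a choice among all normalized maps: facts about the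
  constructed map reach it only that way. Nonemptiness of the hull enters in the strict sign of the
  capacity, which gives the quotients in the theorem their meaning.\<close>

lemma conformal_ontoI:
  assumes "f holomorphic_on D" "g holomorphic_on E"
    and "\<And>z. z \<in> D \<Longrightarrow> f z \<in> E" "\<And>w. w \<in> E \<Longrightarrow> g w \<in> D"
    and gf: "\<And>z. z \<in> D \<Longrightarrow> g (f z) = z" and fg: "\<And>w. w \<in> E \<Longrightarrow> f (g w) = w"
  shows "conformal_onto f D E"
proof -
  have bij: "bij_betw f D E"
    by (rule bij_betw_byWitness[where f' = g]) (use assms in auto)
  have "inv_into D f w = g w" if "w \<in> E" for w
    using bij that assms by (metis bij_betw_def inv_into_f_f)
  then have "inv_into D f holomorphic_on E"
    using assms(2) by (metis holomorphic_transform)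
  with bij assms(1) show ?thesis
    by (simp add: conformal_onto_def)
qed

lemma conformal_onto_inverse:
  assumes "conformal_onto f D E"
  obtains g where "conformal_onto g E D" "\<And>z. z \<in> D \<Longrightarrow> g (f z) = z"
    "\<And>w. w \<in> E \<Longrightarrow> f (g w) = w"
proof -
  have bij: "bij_betw f D E"
    using assms by (simp add: conformal_onto_def)
  have inv: "inv_into D f w \<in> D" "f (inv_into D f w) = w" if "w \<in> E" for w
    using bij that by (auto simp: bij_betw_def inv_into_into f_inv_into_f)
  have inv': "inv_into D f (f z) = z" "f z \<in> E" if "z \<in> D" for z
    using bij that by (auto simp: bij_betw_def)
  have "conformal_onto (inv_into D f) E D"
    by (rule conformal_ontoI[of _ _ f]) (use assms inv inv' in \<open>auto simp: conformal_onto_def\<close>)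
  then show thesis
    by (rule that) (use inv inv' in auto)
qed

lemma conformal_onto_mem: "conformal_onto f D E \<Longrightarrow> z \<in> D \<Longrightarrow> f z \<in> E"
  by (auto simp: conformal_onto_def bij_betw_def)

lemma conformal_onto_inj: "conformal_onto f D E \<Longrightarrow> inj_on f D"
  by (auto simp: conformal_onto_def bij_betw_def)

lemma conformal_onto_holomorphic: "conformal_onto f D E \<Longrightarrow> f holomorphic_on D"
  by (auto simp: conformal_onto_def)

lemma conformal_onto_compose:
  assumes f: "conformal_onto f D E" and h: "conformal_onto h E G"
  shows "conformal_onto (h \<circ> f) D G"
proof -
  obtain f' where f': "conformal_onto f' E D" "\<And>z. z \<in> D \<Longrightarrow> f' (f z) = z"
    "\<And>w. w \<in> E \<Longrightarrow> f (f' w) = w"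
    using conformal_onto_inverse[OF f] by metis
  obtain h' where h': "conformal_onto h' G E" "\<And>z. z \<in> E \<Longrightarrow> h' (h z) = z"
    "\<And>w. w \<in> G \<Longrightarrow> h (h' w) = w"
    using conformal_onto_inverse[OF h] by metis
  note mem = conformal_onto_mem[OF f] conformal_onto_mem[OF h]
    conformal_onto_mem[OF f'(1)] conformal_onto_mem[OF h'(1)]
  show ?thesis
  proof (rule conformal_ontoI[of _ _ "f' \<circ> h'"])
    show "h \<circ> f holomorphic_on D"
      by (rule holomorphic_on_compose_gen[OF conformal_onto_holomorphic[OF f] conformal_onto_holomorphic[OF h]])
        (use mem in auto)
    show "f' \<circ> h' holomorphic_on G"
      by (rule holomorphic_on_compose_gen[OF conformal_onto_holomorphic[OF h'(1)] conformal_onto_holomorphic[OF f'(1)]])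
        (use mem in auto)
  qed (use mem f' h' in auto)
qed

text \<open>Properness, the substitute for boundary continuity: as a point leaves every compact
  subset of \<open>D\<close>, its image leaves every compact subset of \<open>E\<close>.\<close>

lemma conformal_onto_compact_preimage:
  assumes f: "conformal_onto f D E" and K: "compact K" "K \<subseteq> E"
  shows "compact {z \<in> D. f z \<in> K}"
proof -
  obtain g where g: "conformal_onto g E D" "\<And>z. z \<in> D \<Longrightarrow> g (f z) = z"
    "\<And>w. w \<in> E \<Longrightarrow> f (g w) = w"
    using conformal_onto_inverse[OF f] by metis
  have "{z \<in> D. f z \<in> K} = g ` K"
    using K(2) g conformal_onto_mem[OF g(1)] by (force simp: image_iff)
  moreover have "continuous_on K g"
    using conformal_onto_holomorphic[OF g(1)] K(2)
    by (meson continuous_on_subset holomorphic_on_imp_continuous_on)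
  ultimately show ?thesis
    using K(1) by (metis compact_continuous_image)
qed

text \<open>The boundary condition asks for a compact exception set for each \<open>e\<close>, so it
  treats irregular boundary points and infinity alike. A negative value would make
  \<open>Im F\<close> attain its minimum over \<open>U\<close> inside such a set.\<close>

lemma Im_nonneg_maximum_principle:
  assumes F: "F holomorphic_on U" and U: "open U" "connected U"
    and bdry: "\<And>e. e > 0 \<Longrightarrow> \<exists>K. compact K \<and> K \<subseteq> U \<and> (\<forall>z\<in>U - K. - e < Im (F z))"
    and z: "z \<in> U"
  shows "0 \<le> Im (F z)"
proof (rule ccontr)
  assume neg: "\<not> 0 \<le> Im (F z)"
  then obtain K where K: "compact K" "K \<subseteq> U" "\<And>w. w \<in> U - K \<Longrightarrow> Im (F z) < Im (F w)"
    using bdry[of "- Im (F z)"] by auto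
  have zK: "z \<in> K"
    using K(3)[of z] z by auto
  have "continuous_on K (\<lambda>z. Im (F z))"
    by (intro continuous_intros)
      (meson F K(2) continuous_on_subset holomorphic_on_imp_continuous_on)
  then obtain m where m: "m \<in> K" "\<And>w. w \<in> K \<Longrightarrow> Im (F m) \<le> Im (F w)"
    using continuous_attains_inf[OF K(1)] zK by blast
  have min: "Im (F m) \<le> Im (F w)" if "w \<in> U" for w
    using m K(3)[of w] that zK by (cases "w \<in> K") force+
  \<comment> \<open>The modulus of exp (i F) is exp (- Im F), so a minimum of \<open>Im F\<close> is
    a maximum of this modulus.\<close>
  have "(\<lambda>z. exp (\<i> * F z)) constant_on U"
    by (rule maximum_modulus_principle[of _ U U m])
      (use U m K(2) min in \<open>auto intro!: holomorphic_intros F\<close>)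
  then obtain c where c: "\<And>w. w \<in> U \<Longrightarrow> exp (\<i> * F w) = c"
    by (auto simp: constant_on_def)
  have const: "Im (F w) = Im (F z)" if "w \<in> U" for w
  proof -
    have "cmod (exp (\<i> * F w)) = cmod (exp (\<i> * F z))"
      using c z that by simp
    then show ?thesis by simp
  qed
  \<comment> \<open>Points outside \<open>K\<close> would have imaginary part larger than
    \<open>Im (F z)\<close>, against constancy. Then \<open>U\<close> is open and compact in the
    plane, hence empty.\<close>
  have "U = K"
    using K(2,3) const by force
  with K(1) U have "U = {}"
    by (metis clopen compact_imp_closed compact_imp_bounded not_bounded_UNIV)
  with z show False by simp
qed

section \<open>Derivative estimates from control of the imaginary part\<close>

text \<open>This is the Schwarz lemma for maps into a half-plane. After rescaling to the unit disk
  and subtracting \<open>F w\<close>, the imaginary part is at most 2 B, hence below 3 B; the slack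
  supplies the strict inequality used for the disk. The Moebius map in \<open>q\<close> sends that
  half-plane to the disk and fixes 0.\<close>

lemma norm_deriv_le_Im_bound:
  assumes F: "F holomorphic_on ball w r" and r: "0 < r" and B: "0 < B"
    and bd: "\<And>z. z \<in> ball w r \<Longrightarrow> \<bar>Im (F z)\<bar> \<le> B"
  shows "cmod (deriv F w) \<le> 6 * B / r"
proof -
  define G where "G \<zeta> = F (w + of_real r * \<zeta>) - F w" for \<zeta>
  \<comment> \<open>The mirror image of 0 in the line Im = 3 B: being closer to 0 than to
    \<open>c\<close> means lying below that line. The factor 6 of the bound is the modulus of
    \<open>c\<close> over \<open>B\<close>.\<close>
  define c where "c = 6 * \<i> * complex_of_real B"
  define q where "q \<zeta> = G \<zeta> / (G \<zeta> - c)" for \<zeta>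
  have mem: "w + of_real r * \<zeta> \<in> ball w r" if "cmod \<zeta> < 1" for \<zeta>
    using that r by (simp add: dist_norm norm_mult)
  have ImG: "Im (G \<zeta>) < 3 * B" if "cmod \<zeta> < 1" for \<zeta>
    using bd[OF mem[OF that]] bd[of w] r B by (auto simp: G_def)
  have ne: "G \<zeta> - c \<noteq> 0" if "cmod \<zeta> < 1" for \<zeta>
    using ImG[OF that] B by (auto simp: c_def complex_eq_iff)
  have holG: "G holomorphic_on ball 0 1"
    unfolding G_def
    by (intro holomorphic_intros holomorphic_on_compose_gen[OF _ F, unfolded o_def])
      (use mem in auto)
  have holq: "q holomorphic_on ball 0 1"
    unfolding q_def by (intro holomorphic_intros holG) (use ne in auto)
  have lt1: "cmod (q \<zeta>) < 1" if "cmod \<zeta> < 1" for \<zeta>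
  proof -
    have "(cmod (G \<zeta>))\<^sup>2 < (cmod (G \<zeta> - c))\<^sup>2"
    proof -
      have "(cmod (G \<zeta> - c))\<^sup>2 - (cmod (G \<zeta>))\<^sup>2 = 12 * B * (3 * B - Im (G \<zeta>))"
        unfolding cmod_power2 c_def by (simp add: power2_eq_square algebra_simps)
      moreover have "12 * B * (3 * B - Im (G \<zeta>)) > 0"
        using ImG[OF that] B by simp
      ultimately show ?thesis by linarith
    qed
    then have "cmod (G \<zeta>) < cmod (G \<zeta> - c)"
      by (simp add: power2_less_imp_less)
    then show ?thesis
      by (simp add: q_def norm_divide divide_less_eq)
  qed
  have "cmod (deriv q 0) \<le> 1"
    by (rule Schwarz_Lemma(2)[OF holq _ lt1, of 0]) (auto simp: q_def G_def)
  moreover have "deriv q 0 = of_real r * deriv F w / (- c)"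
  proof -
    have dF: "(F has_field_derivative deriv F w) (at (w + of_real r * 0))"
      using F r by (simp add: holomorphic_derivI)
    have dG: "(G has_field_derivative of_real r * deriv F w) (at 0)"
      unfolding G_def
      by (rule derivative_eq_intros DERIV_chain2[where f = F and g = "\<lambda>\<zeta>. w + of_real r * \<zeta>", OF dF] refl | simp)+
    have c0: "c \<noteq> 0" using B by (simp add: c_def)
    have "(q has_field_derivative of_real r * deriv F w / (- c)) (at 0)"
      unfolding q_def
      by (rule derivative_eq_intros dG refl)+ (use c0 in \<open>auto simp: G_def field_simps power2_eq_square\<close>)
    then show ?thesis by (rule DERIV_imp_deriv)
  qed
  ultimately have "r * cmod (deriv F w) / (6 * B) \<le> 1"
    using r B by (simp add: c_def norm_mult norm_divide)
  then show ?thesis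
    using r B by (simp add: pos_divide_le_eq pos_le_divide_eq mult.commute)
qed

text \<open>At a zero of order n the function behaves like b w^n and opens the angle pi of the
  half-disk to n pi. For n at least 2 this covers every direction, including the negative imaginary
  one. So n = 1, and multiplication by b preserves the closed half-plane only if b is a positive
  real.\<close>

lemma boundary_Hopf:
  assumes k: "k holomorphic_on ball 0 r" and r: "0 < r" and k0: "k 0 = 0"
    and nonneg: "\<And>w. w \<in> ball 0 r \<Longrightarrow> 0 < Im w \<Longrightarrow> 0 \<le> Im (k w)"
    and nz: "w0 \<in> ball 0 r" "k w0 \<noteq> 0"
  obtains a :: real where "0 < a" "deriv k 0 = of_real a"
proof -
  have nc: "\<not> k constant_on ball 0 r"
  proof
    assume "k constant_on ball 0 r"
    then obtain c where c: "\<And>w. w \<in> ball 0 r \<Longrightarrow> k w = c"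
      unfolding constant_on_def by blast
    have "k w0 = k 0"
      using c[OF nz(1)] c[of 0] r by simp
    with k0 nz show False by simp
  qed
  have mem0: "0 \<in> ball 0 r" using r by simp
  have "\<exists>h s n. 0 < n \<and> 0 < s \<and> ball 0 s \<subseteq> ball (0::complex) r \<and> h holomorphic_on ball 0 s \<and>
    (\<forall>w\<in>ball 0 s. k w = w ^ n * h w \<and> h w \<noteq> 0)"
  proof (rule holomorphic_factor_zero_nonconstant[OF k open_ball connected_ball mem0 k0 nc])
    fix h s and n :: nat
    assume "0 < n" "0 < s" "ball 0 s \<subseteq> ball (0::complex) r" "h holomorphic_on ball 0 s"
      "\<And>w. w \<in> ball 0 s \<Longrightarrow> k w = (w - 0) ^ n * h w" "\<And>w. w \<in> ball 0 s \<Longrightarrow> h w \<noteq> 0"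
    then show ?thesis
      by (intro exI[of _ h] exI[of _ s] exI[of _ n]) simp
  qed
  then obtain h s n where n: "0 < n" and s: "0 < s" "ball 0 s \<subseteq> ball (0::complex) r"
    and h: "h holomorphic_on ball 0 s" and kh: "\<And>w. w \<in> ball 0 s \<Longrightarrow> k w = w ^ n * h w"
    and hnz: "\<And>w. w \<in> ball 0 s \<Longrightarrow> h w \<noteq> 0"
    by blast
  define b where "b = h 0"
  have b0: "b \<noteq> 0" using hnz s by (simp add: b_def)
  have conth: "continuous (at 0) h"
    using h s by (metis centre_in_ball continuous_on_interior holomorphic_on_imp_continuous_on interior_ball)
  \<comment> \<open>Blow-up along the ray through \<open>u\<close>: k (t u) / t^n tends to u^n b as
    t decreases to 0.\<close>
  have open_half: "0 \<le> Im (u ^ n * b)" if u: "0 < Im u" for u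
  proof -
    have "((\<lambda>t. h (of_real t * u)) \<longlongrightarrow> h (of_real 0 * u)) (at_right 0)"
      by (rule isCont_tendsto_compose[of _ h])
        (use conth in \<open>auto intro!: tendsto_eq_intros\<close>)
    then have lim: "((\<lambda>t. Im (u ^ n * h (of_real t * u))) \<longlongrightarrow> Im (u ^ n * b)) (at_right 0)"
      by (auto intro!: tendsto_intros simp: b_def)
    have "\<forall>\<^sub>F t in at_right 0. 0 \<le> Im (u ^ n * h (of_real t * u))"
      unfolding eventually_at_right_field
    proof (intro exI[of _ "s / (cmod u + 1)"] conjI allI impI)
      show "0 < s / (cmod u + 1)"
        using s by (simp add: add_nonneg_pos)
      fix t :: real assume t: "0 < t" "t < s / (cmod u + 1)"
      have "t * (cmod u + 1) < s"
        using t by (simp add: pos_less_divide_eq add_nonneg_pos)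
      then have "t * cmod u < s"
        using t by (simp add: distrib_left)
      then have mem: "of_real t * u \<in> ball 0 s"
        using t by (simp add: norm_mult)
      have "0 \<le> Im (k (of_real t * u))"
        by (rule nonneg) (use mem s u t in auto)
      also have "k (of_real t * u) = of_real (t ^ n) * (u ^ n * h (of_real t * u))"
        using kh[OF mem] by (simp add: power_mult_distrib)
      also have "Im \<dots> = t ^ n * Im (u ^ n * h (of_real t * u))"
        by simp
      finally show "0 \<le> Im (u ^ n * h (of_real t * u))"
        using zero_less_power[OF t(1), of n] by (simp only: zero_le_mult_iff) linarith
    qed
    then show ?thesis
      by (rule tendsto_lowerbound[OF lim]) simp
  qed
  \<comment> \<open>Real directions must be included: 1 and - 1 give \<open>Im b = 0\<close>, and
    the critical direction chosen below is 1 when its angle is 0.\<close>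
  have half: "0 \<le> Im (u ^ n * b)" if u: "0 \<le> Im u" for u
  proof -
    have "((\<lambda>t. u + \<i> * of_real t) \<longlongrightarrow> u) (at_right 0)"
      by (auto intro!: tendsto_eq_intros)
    then have "((\<lambda>t. Im ((u + \<i> * of_real t) ^ n * b)) \<longlongrightarrow> Im (u ^ n * b)) (at_right 0)"
      by (intro tendsto_intros)
    moreover have "\<forall>\<^sub>F t in at_right 0. 0 \<le> Im ((u + \<i> * of_real t) ^ n * b)"
      unfolding eventually_at_right_field
    proof (intro exI[of _ 1] conjI allI impI)
      fix t :: real assume "0 < t"
      then show "0 \<le> Im ((u + \<i> * of_real t) ^ n * b)"
        using u by (intro open_half) simp
    qed simp
    ultimately show ?thesis
      by (rule tendsto_lowerbound) simp
  qed
  have n1: "n = 1"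
  proof (rule ccontr)
    assume "n \<noteq> 1"
    with n have n2: "2 \<le> n" by simp
    \<comment> \<open>Rotation by \<open>t\<close> turns \<open>b\<close> onto the negative
      imaginary axis. Because n is at least 2, the n-th root with angle t / n stays in the closed
      half-plane.\<close>
    define t where "t = Arg2pi (- \<i> * cnj b)"
    have t: "0 \<le> t" "t < 2 * pi" "- \<i> * cnj b = of_real (cmod (- \<i> * cnj b)) * exp (\<i> * of_real t)"
      using Arg2pi_ge_0 Arg2pi_lt_2pi Arg2pi_eq[of "- \<i> * cnj b"] by (auto simp: t_def mult_ac)
    define u where "u = exp (\<i> * of_real (t / n))"
    have "t / n \<le> pi"
    proof -
      have "t \<le> 2 * pi" using t by simp
      also have "\<dots> \<le> n * pi" using n2 by simp
      finally show ?thesis using n by (simp add: field_simps)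
    qed
    then have "0 \<le> Im u"
      using t by (simp add: u_def Im_exp sin_ge_zero)
    then have "0 \<le> Im (u ^ n * b)" by (rule half)
    moreover have "u ^ n = exp (\<i> * of_real t)"
      using n by (simp add: u_def flip: exp_of_nat_mult)
    ultimately have "0 \<le> cmod b * Im (exp (\<i> * of_real t) * b)" by simp
    also have "\<dots> = Im (of_real (cmod (- \<i> * cnj b)) * exp (\<i> * of_real t) * b)"
      by (simp add: norm_mult algebra_simps)
    also have "\<dots> = Im (- \<i> * cnj b * b)"
      by (rule arg_cong[where f = "\<lambda>x. Im (x * b)", OF t(3)[symmetric]])
    also have "\<dots> = - (cmod b)\<^sup>2"
      unfolding cmod_power2 by (simp add: power2_eq_square)
    finally show False using b0 by simp
  qed
  have re: "0 \<le> Re b" and im: "Im b = 0"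
    using half[of \<i>] half[of 1] half[of "-1"] n1 by auto
  have "deriv k 0 = b"
  proof -
    have "((\<lambda>w. w * h w) has_field_derivative b) (at 0)"
      by (rule derivative_eq_intros holomorphic_derivI[OF h] refl | use s in \<open>simp add: b_def\<close>)+
    then have "(k has_field_derivative b) (at 0)"
      by (rule has_field_derivative_transform_within_open[of _ _ _ "ball 0 s"]) (use s kh n1 in auto)
    then show ?thesis by (rule DERIV_imp_deriv)
  qed
  then show thesis
    using that[of "Re b"] re im b0 by (auto simp: complex_eq_iff)
qed

subsection \<open>Schwarz reflection for vanishing imaginary part\<close>

text \<open>The barrier is M / h^2 times (Re z - x)^2 + 2 h Im z - (Im z)^2, the real part of a
  quadratic polynomial. On a rectangle above the axis centred at x = \<open>Re w\<close> it is
  nonnegative, at least \<open>M\<close> on the top and the vertical sides, and at most 2 M Im z / h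
  on the centre line.\<close>

lemma Im_linear_bound:
  fixes F :: "complex \<Rightarrow> complex" and r M :: real
  defines "S \<equiv> {w. cmod w < r \<and> 0 < Im w}"
  assumes F: "F holomorphic_on S" and r: "0 < r"
    and M: "\<And>w. w \<in> S \<Longrightarrow> \<bar>Im (F w)\<bar> \<le> M"
    and lim: "\<And>e. e > 0 \<Longrightarrow> \<exists>d>0. \<forall>w\<in>S. Im w < d \<longrightarrow> \<bar>Im (F w)\<bar> \<le> e"
    and w: "\<bar>Re w\<bar> < r / 4" "0 < Im w" "Im w < r / 4"
  shows "\<bar>Im (F w)\<bar> \<le> 8 * M * Im w / r"
proof -
  \<comment> \<open>With this \<open>h\<close> the rectangle of half-width and height
    \<open>h\<close> about \<open>Re w\<close> lies in the half-disk, and 2 M / h becomes 8 M /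
    r.\<close>
  define h where "h = r / 4"
  define x where "x = Re w"
  have h: "0 < h" using r by (simp add: h_def)
  have inS: "z \<in> S" if "\<bar>Re z - x\<bar> \<le> h" "0 < Im z" "Im z \<le> h" for z
  proof -
    have "cmod z \<le> \<bar>Re z\<bar> + \<bar>Im z\<bar>" by (rule cmod_le)
    also have "\<dots> < 4 * h" 
    proof -
      have "\<bar>Re z\<bar> < 2 * h"
        using that(1) w(1) unfolding x_def h_def by linarith
      then show ?thesis using that by simp
    qed
    finally show ?thesis using that by (simp add: S_def h_def)
  qed
  have M0: "0 \<le> M"
    using M[OF inS[of w]] w by (auto simp: x_def h_def)
  have signed: "\<sigma> * Im (F w) \<le> M / h\<^sup>2 * (2 * h * Im w - (Im w)\<^sup>2)" if \<sigma>: "\<sigma> = 1 \<or> \<sigma> = -1" for \<sigma> :: real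
  proof (rule field_le_epsilon)
    fix e :: real assume e: "0 < e"
    obtain d where d: "0 < d" "\<And>z. z \<in> S \<Longrightarrow> Im z < d \<Longrightarrow> \<bar>Im (F z)\<bar> \<le> e"
      using lim[OF e] by blast
    \<comment> \<open>\<open>F\<close> is not defined on the real axis, so the bottom edge is raised
      to a height where \<open>Im F\<close> is at most \<open>e\<close>, yet not above
      \<open>w\<close>. The error \<open>e\<close> is removed at the end.\<close>
    define \<delta> where "\<delta> = min (d / 2) (Im w)"
    have \<delta>: "0 < \<delta>" "\<delta> < d" "\<delta> \<le> Im w" using d w by (auto simp: \<delta>_def)
    define R where "R = cbox (Complex (x - h) \<delta>) (Complex (x + h) h)"
    have RI: "z \<in> R \<longleftrightarrow> \<bar>Re z - x\<bar> \<le> h \<and> \<delta> \<le> Im z \<and> Im z \<le> h" for z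
      by (auto simp: R_def in_cbox_complex_iff abs_le_iff)
    have RS: "R \<subseteq> S"
      using RI inS \<delta> by force
    define f where "f z = - \<i> * of_real \<sigma> * F z
      - of_real (M / h\<^sup>2) * ((z - of_real x)\<^sup>2 - 2 * \<i> * of_real h * (z - of_real x))" for z
    have Ref: "Re (f z) = \<sigma> * Im (F z) - M / h\<^sup>2 * ((Re z - x)\<^sup>2 + (2 * h * Im z - (Im z)\<^sup>2))" for z
    proof -
      have "Re (- \<i> * of_real \<sigma> * F z - of_real c * ((z - of_real x)\<^sup>2 - 2 * \<i> * of_real h * (z - of_real x)))
        = \<sigma> * Im (F z) - c * ((Re z - x)\<^sup>2 + (2 * h * Im z - (Im z)\<^sup>2))" for c
        by (simp add: power2_eq_square algebra_simps)
      then show ?thesis unfolding f_def .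
    qed
    have holf: "f holomorphic_on S"
      unfolding f_def by (intro holomorphic_intros F)
    have "Re (f w) \<le> e"
    proof (rule maximum_real_frontier[of f R])
      show "f holomorphic_on interior R"
        using holf RS interior_subset holomorphic_on_subset by blast
      show "continuous_on (closure R) f"
        using holf RS by (simp add: R_def) (meson continuous_on_subset holomorphic_on_imp_continuous_on)
      show "bounded R" by (simp add: R_def)
      show "w \<in> R" using w h \<delta> by (simp add: RI x_def h_def)
      fix z assume "z \<in> frontier R"
      then have zR: "z \<in> R" and edge: "\<bar>Re z - x\<bar> = h \<or> Im z = \<delta> \<or> Im z = h"
        unfolding R_def frontier_cbox by (auto simp: in_cbox_complex_iff in_box_complex_iff)
      have z: "0 < Im z" "Im z \<le> h" "z \<in> S" "\<delta> \<le> Im z"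
        using zR RI RS \<delta> by force+
      have q: "0 \<le> 2 * h * Im z - (Im z)\<^sup>2"
      proof -
        have "Im z * Im z \<le> h * Im z" using z by (intro mult_right_mono) auto
        moreover have "0 \<le> h * Im z" using z h by simp
        ultimately show ?thesis by (simp add: power2_eq_square)
      qed
      define b where "b = (Re z - x)\<^sup>2 + (2 * h * Im z - (Im z)\<^sup>2)"
      have b0: "0 \<le> b" using q by (simp add: b_def)
      \<comment> \<open>On the bottom edge \<open>Im F\<close> is small and the barrier nonnegative;
        on the other three edges the barrier alone dominates \<open>M\<close>.\<close>
      consider "Im z = \<delta>" | "h\<^sup>2 \<le> b"
      proof -
        have "h\<^sup>2 \<le> b" if "\<bar>Re z - x\<bar> = h"
          using that q by (metis b_def le_add_same_cancel1 power2_abs)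
        moreover have "h\<^sup>2 \<le> b" if "Im z = h"
          using that by (simp add: b_def power2_eq_square)
        ultimately show thesis using edge that by blast
      qed
      then show "Re (f z) \<le> e"
      proof cases
        case 1
        have "\<sigma> * Im (F z) \<le> e"
          using d(2)[OF z(3)] 1 \<delta> \<sigma> by (auto simp: abs_le_iff)
        moreover have "0 \<le> M / h\<^sup>2 * b" using b0 M0 by simp
        ultimately show ?thesis unfolding Ref b_def by linarith
      next
        case 2
        have "\<sigma> * Im (F z) \<le> M"
          using M[OF z(3)] \<sigma> by (auto simp: abs_le_iff)
        moreover have "M \<le> M / h\<^sup>2 * b"
        proof -
          have "M / h\<^sup>2 * h\<^sup>2 \<le> M / h\<^sup>2 * b"
            using 2 M0 by (intro mult_left_mono) auto
          then show ?thesis using h by simp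
        qed
        ultimately show ?thesis using e unfolding Ref b_def by linarith
      qed
    qed
    then show "\<sigma> * Im (F w) \<le> M / h\<^sup>2 * (2 * h * Im w - (Im w)\<^sup>2) + e"
      unfolding Ref by (simp add: x_def)
  qed
  have "\<bar>Im (F w)\<bar> \<le> M / h\<^sup>2 * (2 * h * Im w - (Im w)\<^sup>2)"
    using signed[of 1] signed[of "-1"] by (auto simp: abs_le_iff)
  also have "\<dots> \<le> M / h\<^sup>2 * (2 * h * Im w)"
    using M0 by (intro mult_left_mono) auto
  also have "\<dots> = 8 * M * Im w / r"
    using h by (simp add: h_def power2_eq_square field_simps)
  finally show ?thesis .
qed

text \<open>Classical reflection requires \<open>F\<close> itself to be continuous up to the axis,
  whereas only \<open>Im F\<close> is controlled here. A derivative bound uniform up to the axis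
  makes \<open>F\<close> Lipschitz on a convex box, and this recovers the real part.\<close>

lemma Schwarz_reflection_Im:
  fixes F :: "complex \<Rightarrow> complex" and r M :: real
  defines "S \<equiv> {w. cmod w < r \<and> 0 < Im w}"
  assumes F: "F holomorphic_on S" and r: "0 < r"
    and M: "\<And>w. w \<in> S \<Longrightarrow> \<bar>Im (F w)\<bar> \<le> M"
    and lim: "\<And>e. e > 0 \<Longrightarrow> \<exists>d>0. \<forall>w\<in>S. Im w < d \<longrightarrow> \<bar>Im (F w)\<bar> \<le> e"
  obtains G s where "0 < s" "s \<le> r" "G holomorphic_on ball 0 s"
    "\<And>w. w \<in> ball 0 s \<Longrightarrow> 0 < Im w \<Longrightarrow> G w = F w"
    "\<And>w. w \<in> ball 0 s \<Longrightarrow> Im w = 0 \<Longrightarrow> Im (G w) = 0"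
proof -
  \<comment> \<open>The linear bound holds up to r / 4 = 2 s. The box \<open>T\<close> has size
    \<open>s\<close>, which leaves room for disks of radius \<open>Im w / 2\<close> around its
    points.\<close>
  define s where "s = r / 8"
  \<comment> \<open>The maximum with 1 makes the bound strictly positive, as the derivative estimate
    demands.\<close>
  define N where "N = max M 1"
  have s: "0 < s" "r = 8 * s" using r by (auto simp: s_def)
  have lin: "\<bar>Im (F w)\<bar> \<le> N * Im w / s" if "\<bar>Re w\<bar> < 2 * s" "0 < Im w" "Im w < 2 * s" for w
  proof -
    have "\<bar>Im (F w)\<bar> \<le> 8 * N * Im w / r"
    proof (rule Im_linear_bound[OF F[unfolded S_def] r _ lim[unfolded S_def]])
      fix v assume "v \<in> {w. cmod w < r \<and> 0 < Im w}"
      then show "\<bar>Im (F v)\<bar> \<le> N" using M[of v] by (auto simp: S_def N_def)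
    qed (use that s in auto)
    then show ?thesis using s by simp
  qed
  define T where "T = {w. \<bar>Re w\<bar> < s \<and> 0 < Im w \<and> Im w < s}"
  have T_eq: "T = box (Complex (- s) 0) (Complex s s)"
    by (auto simp: T_def in_box_complex_iff)
  have "convex T" "open T" unfolding T_eq by (rule convex_box open_box)+
  have TS: "T \<subseteq> S"
  proof
    fix w assume "w \<in> T"
    then show "w \<in> S" using cmod_le[of w] s by (auto simp: T_def S_def)
  qed
  have dF: "(F has_field_derivative deriv F w) (at w within T)" if "w \<in> T" for w
    by (rule holomorphic_derivI[OF holomorphic_on_subset[OF F TS] \<open>open T\<close> that])
  have bdF: "cmod (deriv F w) \<le> 18 * N / s" if w: "w \<in> T" for w
  proof -
    \<comment> \<open>On the disk of radius \<open>Im w / 2\<close> the height is at most 3/2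
      \<open>Im w\<close>. Both \<open>B\<close> and the radius are proportional to
      \<open>Im w\<close>, so their quotient is the uniform constant 18 N / s.\<close>
    define B where "B = 3 / 2 * N * Im w / s"
    have near: "\<bar>Re z - Re w\<bar> < Im w / 2 \<and> \<bar>Im z - Im w\<bar> < Im w / 2" if "z \<in> ball w (Im w / 2)" for z
    proof -
      have "\<bar>Re (z - w)\<bar> \<le> cmod (z - w)" "\<bar>Im (z - w)\<bar> \<le> cmod (z - w)"
        by (rule abs_Re_le_cmod abs_Im_le_cmod)+
      then show ?thesis using that by (simp add: dist_norm norm_minus_commute)
    qed
    have in2: "\<bar>Re z\<bar> < 2 * s \<and> 0 < Im z \<and> Im z < 2 * s" if "z \<in> ball w (Im w / 2)" for z
      proof -
      have "\<bar>Re w\<bar> < s" "Im w < s" "0 < Im w" using w by (auto simp: T_def)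
      with near[OF that] show ?thesis by linarith
    qed
    have "cmod (deriv F w) \<le> 6 * B / (Im w / 2)"
    proof (rule norm_deriv_le_Im_bound)
      have "ball w (Im w / 2) \<subseteq> S"
      proof
        fix z assume "z \<in> ball w (Im w / 2)"
        then show "z \<in> S" using cmod_le[of z] in2[of z] s by (auto simp: S_def)
      qed
      then show "F holomorphic_on ball w (Im w / 2)"
        using F holomorphic_on_subset by blast
      show "0 < Im w / 2" "0 < B" using w s by (auto simp: T_def B_def N_def)
      fix z assume z: "z \<in> ball w (Im w / 2)"
      have "\<bar>Im (F z)\<bar> \<le> N * Im z / s" using lin in2[OF z] by blast
      also have "\<dots> \<le> N * (3 / 2 * Im w) / s"
      proof -
        have "Im z \<le> 3 / 2 * Im w" using near[OF z] by linarith
        then show ?thesis using s by (intro divide_right_mono mult_left_mono) (auto simp: N_def)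
      qed
      finally show "\<bar>Im (F z)\<bar> \<le> B" by (simp add: B_def mult_ac)
    qed
    also have "\<dots> = 18 * N / s" using w by (simp add: B_def T_def field_simps)
    finally show ?thesis .
  qed
  have "(18 * N / s)-lipschitz_on T F"
  proof (rule lipschitz_onI)
    fix x y assume "x \<in> T" "y \<in> T"
    then show "dist (F x) (F y) \<le> 18 * N / s * dist x y"
      using field_differentiable_bound[OF \<open>convex T\<close> dF bdF, of x y] by (simp add: dist_norm)
  qed (use s in \<open>simp add: N_def\<close>)
  then obtain g where g: "\<And>x. x \<in> T \<Longrightarrow> F x = g x" "uniformly_continuous_on (closure T) g"
    using lipschitz_on_uniformly_continuous uniformly_continuous_on_extension_on_closure by metis
  then have contg: "continuous_on (closure T) g"
    using uniformly_continuous_imp_continuous by blast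
  have ball_T: "w \<in> T" if "w \<in> ball 0 s" "0 < Im w" for w
    using that abs_Re_le_cmod[of w] abs_Im_le_cmod[of w] by (auto simp: T_def)
  have approach: "w + \<i> * of_real t \<in> T" if "w \<in> ball 0 s" "Im w = 0" "0 < t" "t < s" for w t
    using that abs_Re_le_cmod[of w] by (auto simp: T_def)
  have lim_i: "((\<lambda>t. w + \<i> * of_real t) \<longlongrightarrow> w) (at_right 0)" for w
    by (auto intro!: tendsto_eq_intros)
  have ev: "\<forall>\<^sub>F t in at_right 0. w + \<i> * of_real t \<in> T" if "w \<in> ball 0 s" "Im w = 0" for w
    unfolding eventually_at_right_field using approach[OF that] s by blast
  have real_closure: "w \<in> closure T" if "w \<in> ball 0 s" "Im w = 0" for w
    by (rule Lim_in_closed_set[OF closed_closure _ _ lim_i])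
      (use ev[OF that] closure_subset[of T] in \<open>auto elim!: eventually_mono\<close>)
  \<comment> \<open>The extension comes without a formula on the axis; its imaginary part is found
    by vertical approach, where the linear bound forces it to 0.\<close>
  have real_val: "Im (g w) = 0" if w: "w \<in> ball 0 s" "Im w = 0" for w
  proof (rule tendsto_unique[of "at_right (0::real)"])
    have "\<forall>\<^sub>F t in at_right 0. w + \<i> * of_real t \<in> closure T"
      using ev[OF w] closure_subset[of T] by (auto elim!: eventually_mono)
    then have "((\<lambda>t. g (w + \<i> * of_real t)) \<longlongrightarrow> g w) (at_right 0)"
      by (rule continuous_on_tendsto_compose[OF contg lim_i real_closure[OF w]])
    then show "((\<lambda>t. Im (g (w + \<i> * of_real t))) \<longlongrightarrow> Im (g w)) (at_right 0)"
      by (rule tendsto_Im)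
    show "((\<lambda>t. Im (g (w + \<i> * of_real t))) \<longlongrightarrow> 0) (at_right 0)"
    proof (rule Lim_null_comparison)
      show "\<forall>\<^sub>F t in at_right 0. norm (Im (g (w + \<i> * of_real t))) \<le> N * t / s"
        using ev[OF w]
      proof (rule eventually_mono)
        fix t assume t: "w + \<i> * of_real t \<in> T"
        show "norm (Im (g (w + \<i> * of_real t))) \<le> N * t / s"
          using lin[of "w + \<i> * of_real t"] t w s g(1)[OF t] by (auto simp: T_def)
      qed
      show "((\<lambda>t. N * t / s) \<longlongrightarrow> 0) (at_right 0)"
        using s by (auto intro!: tendsto_eq_intros)
    qed
  qed simp
  define G where "G z = (if 0 \<le> Im z then g z else cnj (g (cnj z)))" for z
  show thesis
  proof (rule that[of s G])
    show "G holomorphic_on ball 0 s"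
      unfolding G_def
    proof (rule Schwarz_reflection)
      show "g holomorphic_on ball 0 s \<inter> {z. 0 < Im z}"
        by (rule holomorphic_transform[of F])
          (use F TS ball_T g(1) in \<open>auto intro!: holomorphic_on_subset[OF F]\<close>)
      show "continuous_on (ball 0 s \<inter> {z. 0 \<le> Im z}) g"
      proof (rule continuous_on_subset[OF contg])
        show "ball 0 s \<inter> {z. 0 \<le> Im z} \<subseteq> closure T"
        proof
          fix z assume z: "z \<in> ball 0 s \<inter> {z. 0 \<le> Im z}"
          then consider "0 < Im z" | "Im z = 0" by (auto simp: le_less)
          then show "z \<in> closure T"
            by cases (use z ball_T[of z] real_closure[of z] closure_subset[of T] in auto)
        qed
      qed
      show "g z \<in> \<real>" if "z \<in> ball 0 s" "z \<in> \<real>" for z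
        using real_val[of z] that by (simp add: complex_is_Real_iff)
    qed auto
  qed (use s real_val g(1) ball_T in \<open>auto simp: G_def\<close>)
qed

subsection \<open>Hydrodynamically normalized maps\<close>

lemma half_plane_mem: "z \<in> \<H> \<longleftrightarrow> 0 < Im z"
  by (simp add: upper_half_plane_def)

lemma open_half_plane: "open \<H>"
  unfolding upper_half_plane_def by (rule open_halfspace_Im_gt)

lemma Im_minus_inverse: "Im (- 1 / z) = Im z / (cmod z)\<^sup>2"
  by (simp add: Im_divide cmod_power2)

lemma minus_inverse_half_plane: "z \<in> \<H> \<Longrightarrow> - 1 / z \<in> \<H>"
  unfolding half_plane_mem Im_minus_inverse by (auto intro!: divide_pos_pos)

lemma eventually_hull_at_infinity:
  "eventually P (hull_at_infinity A) \<longleftrightarrow> (\<exists>b. \<forall>z\<in>\<H> - A. b \<le> cmod z \<longrightarrow> P z)"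
  unfolding hull_at_infinity_def eventually_inf_principal eventually_at_infinity by blast

lemma half_plane_hull_bounded:
  assumes "half_plane_hull A"
  obtains R where "0 < R" "\<And>z. z \<in> A \<Longrightarrow> cmod z < R"
  using assms unfolding half_plane_hull_def
  by (metis bounded_pos_less)

text \<open>The map - 1 / w carries a half-disk, which is convex, onto this nonconvex set.\<close>

lemma connected_half_plane_exterior:
  assumes "0 < M"
  shows "connected {w. M < cmod w \<and> 0 < Im w}"
proof -
  have "connected ((\<lambda>w. - 1 / w) ` (ball 0 (1 / M) \<inter> {w. 0 < Im w}))"
  proof (intro connected_continuous_image convex_connected)
    show "continuous_on (ball 0 (1 / M) \<inter> {w. 0 < Im w}) (\<lambda>w. - 1 / w)"
      by (intro continuous_intros) auto
    show "convex (ball 0 (1 / M) \<inter> {w::complex. 0 < Im w})"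
      by (intro convex_Int convex_ball convex_halfspace_Im_gt)
  qed
  also have "(\<lambda>w. - 1 / w) ` (ball 0 (1 / M) \<inter> {w. 0 < Im w}) = {w. M < cmod w \<and> 0 < Im w}"
  proof safe
    fix w :: complex assume w: "w \<in> ball 0 (1 / M)" "0 < Im w"
    then have "w \<noteq> 0" by auto
    show "M < cmod (- 1 / w)"
      using w assms \<open>w \<noteq> 0\<close> by (simp add: norm_divide field_simps)
    show "0 < Im (- 1 / w)"
      unfolding Im_minus_inverse using w \<open>w \<noteq> 0\<close> by simp
  next
    fix w :: complex assume w: "M < cmod w" "0 < Im w"
    then have "w \<noteq> 0" by auto
    show "w \<in> (\<lambda>w. - 1 / w) ` (ball 0 (1 / M) \<inter> {w. 0 < Im w})"
    proof (rule image_eqI[of _ _ "- 1 / w"])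
      have "0 < Im (- 1 / w)"
        unfolding Im_minus_inverse using w \<open>w \<noteq> 0\<close> by simp
      then show "- 1 / w \<in> ball 0 (1 / M) \<inter> {w. 0 < Im w}"
        using w assms \<open>w \<noteq> 0\<close> by (simp add: norm_divide field_simps)
    qed simp
  qed
  finally show ?thesis .
qed

lemma hydrodynamic_map_bound:
  assumes A: "half_plane_hull A" and g: "hydrodynamic_map A g"
  obtains C R where "0 < C" "0 < R" "\<And>z. z \<in> \<H> \<Longrightarrow> R \<le> cmod z \<Longrightarrow> z \<notin> A"
    "\<And>z. z \<in> \<H> \<Longrightarrow> R \<le> cmod z \<Longrightarrow> cmod (g z - z) \<le> C / cmod z"
proof -
  have "(\<lambda>z. g z - z) \<in> O[hull_at_infinity A](\<lambda>z. 1 / z)"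
    using g by (simp add: hydrodynamic_map_def)
  then obtain C b where C: "0 < C"
    "\<And>z. z \<in> \<H> - A \<Longrightarrow> b \<le> cmod z \<Longrightarrow> cmod (g z - z) \<le> C * cmod (1 / z)"
    unfolding bigo_def eventually_hull_at_infinity by blast
  obtain R where R: "0 < R" "\<And>z. z \<in> A \<Longrightarrow> cmod z < R"
    using half_plane_hull_bounded[OF A] by metis
  show thesis
    by (rule that[of C "max R b"]) (use C R in \<open>force simp: norm_divide\<close>)+
qed

section \<open>Boundary behaviour, comparison and uniqueness of normalized maps\<close>

text \<open>The normalization sends large points to large points; the converse comes from
  connectedness. The exterior half-plane \<open>N\<close> is covered by the disjoint open images of
  \<open>V\<close> and \<open>W\<close>, since the circle of radius \<open>R\<close> maps into
  modulus at most R + 1. It meets the image of \<open>V\<close>, so it misses that of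
  \<open>W\<close>.\<close>

lemma hydrodynamic_map_proper:
  assumes A: "half_plane_hull A" and g: "hydrodynamic_map A g"
    and R: "0 < R" "\<And>z. z \<in> \<H> \<Longrightarrow> R \<le> cmod z \<Longrightarrow> z \<notin> A"
    and near: "\<And>z. z \<in> \<H> \<Longrightarrow> R \<le> cmod z \<Longrightarrow> cmod (g z - z) \<le> 1"
    and z: "z \<in> \<H> - A" "R + 1 < cmod (g z)"
  shows "R < cmod z"
proof -
  have conf: "conformal_onto g (\<H> - A) \<H>"
    using g by (simp add: hydrodynamic_map_def)
  have hol: "g holomorphic_on \<H> - A" and inj: "inj_on g (\<H> - A)"
    using conf conformal_onto_holomorphic conformal_onto_inj by blast+
  define N where "N = {w. R + 1 < cmod w \<and> 0 < Im w}"
  define V where "V = {z \<in> \<H> - A. R < cmod z}"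
  define W where "W = {z \<in> \<H> - A. cmod z < R}"
  have opn: "open (\<H> - A)" using A by (simp add: half_plane_hull_def region_def)
  have oVW: "open V" "open W"
  proof -
    have "V = (\<H> - A) \<inter> - cball 0 R" "W = (\<H> - A) \<inter> ball 0 R" by (auto simp: V_def W_def)
    then show "open V" "open W" using opn by (auto intro!: open_Int)
  qed
  have oim: "open (g ` V)" "open (g ` W)"
    by (rule open_mapping_thm3; use oVW hol inj in
      \<open>auto simp: V_def W_def intro: holomorphic_on_subset inj_on_subset\<close>)+
  have cover: "N \<subseteq> g ` V \<union> g ` W"
  proof
    fix w assume w: "w \<in> N"
    then have "w \<in> g ` (\<H> - A)"
      using conf by (simp add: N_def conformal_onto_def bij_betw_def half_plane_mem)
    then obtain v where v: "v \<in> \<H> - A" "w = g v" by blast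
    have "cmod v \<noteq> R"
    proof
      assume "cmod v = R"
      then have "cmod (g v - v) \<le> 1" using near[of v] v by simp
      then have "cmod (g v) \<le> R + 1"
        using norm_triangle_sub[of "g v" v] \<open>cmod v = R\<close> by linarith
      then show False using w v by (simp add: N_def)
    qed
    then have "v \<in> V \<union> W" using v(1) by (auto simp: V_def W_def)
    then show "w \<in> g ` V \<union> g ` W" using v(2) by blast
  qed
  have disj: "g ` V \<inter> g ` W \<inter> N = {}"
  proof -
    have "V \<subseteq> \<H> - A" "W \<subseteq> \<H> - A" "V \<inter> W = {}" by (auto simp: V_def W_def)
    then have "g ` V \<inter> g ` W = {}" using inj_on_image_Int[OF inj, of V W] by simp
    then show ?thesis by simp
  qed
  have "connected N"
    unfolding N_def by (rule connected_half_plane_exterior) (use R in simp)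
  moreover have "g ` V \<inter> N \<noteq> {}"
  proof -
    \<comment> \<open>Moving by at most 1 leaves the image with modulus at least R + 2, safely
      inside \<open>N\<close>.\<close>
    define v where "v = \<i> * complex_of_real (R + 3)"
    have v: "v \<in> \<H>" "cmod v = R + 3" using R by (auto simp: v_def half_plane_mem norm_mult)
    then have "cmod (g v - v) \<le> 1" "v \<notin> A" using near[of v] R(2)[of v] by auto
    then have "R + 2 \<le> cmod (g v)"
      using norm_triangle_ineq2[of v "g v"] v(2) by (simp add: norm_minus_commute)
    moreover have "g v \<in> \<H>" using conformal_onto_mem[OF conf] v \<open>v \<notin> A\<close> by simp
    ultimately have "g v \<in> N" "v \<in> V" using v \<open>v \<notin> A\<close> by (auto simp: N_def V_def half_plane_mem)
    then show ?thesis by blast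
  qed
  ultimately have "g ` W \<inter> N = {}"
    using connectedD[OF _ oim disj cover] by blast
  moreover have "g z \<in> N"
    using z conformal_onto_mem[OF conf z(1)] by (simp add: N_def half_plane_mem)
  ultimately have "z \<notin> W" by blast
  moreover have "cmod z \<noteq> R"
  proof
    assume "cmod z = R"
    then have "cmod (g z - z) \<le> 1" using near[of z] z by simp
    then show False
      using norm_triangle_sub[of "g z" z] \<open>cmod z = R\<close> z(2) by linarith
  qed
  ultimately show ?thesis using z by (auto simp: W_def)
qed

text \<open>Packages the two ends of the domain for the maximum principle: closeness to the identity
  far out, and small imaginary part near the finite boundary. For the latter, compact preimages
  exclude images of moderate size with height at least \<open>e\<close>, and the preceding lemma
  excludes large ones.\<close>

lemma hydrodynamic_map_boundary:
  assumes A: "half_plane_hull A" and g: "hydrodynamic_map A g" and e: "0 < e"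
  obtains R0 where "0 < R0"
    "\<And>z. z \<in> \<H> - A \<Longrightarrow> R0 \<le> cmod z \<Longrightarrow> cmod (g z - z) < e"
    "\<And>R. R0 \<le> R \<Longrightarrow> \<exists>K. compact K \<and> K \<subseteq> \<H> - A \<and>
      (\<forall>z\<in>\<H> - A - K. cmod z \<le> R \<longrightarrow> Im (g z) < e)"
proof -
  have conf: "conformal_onto g (\<H> - A) \<H>"
    using g by (simp add: hydrodynamic_map_def)
  obtain C R1 where C: "0 < C" "0 < R1" "\<And>z. z \<in> \<H> \<Longrightarrow> R1 \<le> cmod z \<Longrightarrow> z \<notin> A"
    "\<And>z. z \<in> \<H> \<Longrightarrow> R1 \<le> cmod z \<Longrightarrow> cmod (g z - z) \<le> C / cmod z"
    using hydrodynamic_map_bound[OF A g] by metis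
  have near: "cmod (g z - z) \<le> d" if "z \<in> \<H>" "R1 + C / d \<le> cmod z" "0 < d" for z d
  proof -
    have "0 < C / d" using C that by simp
    then have *: "R1 \<le> cmod z" "C / d \<le> cmod z" "0 < cmod z" using that C by linarith+
    then have "C / cmod z \<le> d" using that by (simp add: field_simps)
    with C(4)[OF that(1) *(1)] show ?thesis by linarith
  qed
  \<comment> \<open>The second term makes the displacement at most \<open>e / 2\<close>; the third
    makes it at most 1, as the connectedness argument requires.\<close>
  define R0 where "R0 = R1 + C / (e / 2) + C / 1"
  have R0: "R1 + C / (e / 2) \<le> R0" "R1 + C / 1 \<le> R0" "R1 \<le> R0" "0 < R0"
    using C e by (auto simp: R0_def intro!: add_pos_pos)
  show thesis
  proof (rule that[of R0])
    show "0 < R0" by fact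
    fix z assume z: "z \<in> \<H> - A" "R0 \<le> cmod z"
    have "cmod (g z - z) \<le> e / 2"
      by (rule near) (use z R0 e in auto)
    then show "cmod (g z - z) < e" using e by simp
  next
    fix R assume R: "R0 \<le> R"
    define K where "K = {z \<in> \<H> - A. g z \<in> {w. e \<le> Im w \<and> cmod w \<le> R + 1}}"
    have "compact {w. e \<le> Im w \<and> cmod w \<le> R + 1}"
    proof -
      have "{w. e \<le> Im w \<and> cmod w \<le> R + 1} = cball 0 (R + 1) \<inter> {w. e \<le> Im w}" by auto
      then show ?thesis by (auto intro!: compact_Int_closed closed_halfspace_Im_ge)
    qed
    then have "compact K"
      unfolding K_def by (rule conformal_onto_compact_preimage[OF conf])
        (use e in \<open>auto simp: half_plane_mem\<close>)
    moreover have "Im (g z) < e" if z: "z \<in> \<H> - A" "z \<notin> K" "cmod z \<le> R" for z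
    proof (rule ccontr)
      assume "\<not> Im (g z) < e"
      then have "R + 1 < cmod (g z)" using z by (auto simp: K_def)
      then have "R < cmod z"
        by (rule hydrodynamic_map_proper[OF A g _ _ _ z(1), of R, rotated -1])
          (use R R0 C near[of _ 1] in auto)
      with z show False by simp
    qed
    moreover have "K \<subseteq> \<H> - A" by (auto simp: K_def)
    ultimately show "\<exists>K. compact K \<and> K \<subseteq> \<H> - A \<and> (\<forall>z\<in>\<H> - A - K. cmod z \<le> R \<longrightarrow> Im (g z) < e)"
      by blast
  qed
qed

text \<open>At the finite boundary \<open>Im z\<close> is positive and \<open>Im (g z)\<close> tends
  to 0, while at infinity the difference tends to 0.\<close>

lemma hydrodynamic_map_Im_le:
  assumes A: "half_plane_hull A" and g: "hydrodynamic_map A g" and z: "z \<in> \<H> - A"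
  shows "Im (g z) \<le> Im z"
proof -
  have conf: "conformal_onto g (\<H> - A) \<H>"
    using g by (simp add: hydrodynamic_map_def)
  have opn: "open (\<H> - A)" "connected (\<H> - A)" using A by (auto simp: half_plane_hull_def region_def)
  have "0 \<le> Im (z - g z)"
  proof (rule Im_nonneg_maximum_principle[OF _ opn _ z])
    show "(\<lambda>z. z - g z) holomorphic_on \<H> - A"
      by (intro holomorphic_intros conformal_onto_holomorphic[OF conf])
    fix e :: real assume e: "0 < e"
    obtain R0 where R0: "\<And>z. z \<in> \<H> - A \<Longrightarrow> R0 \<le> cmod z \<Longrightarrow> cmod (g z - z) < e"
      "\<exists>K. compact K \<and> K \<subseteq> \<H> - A \<and> (\<forall>z\<in>\<H> - A - K. cmod z \<le> R0 \<longrightarrow> Im (g z) < e)"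
      using hydrodynamic_map_boundary[OF A g e] by (metis order_refl)
    then obtain K where K: "compact K" "K \<subseteq> \<H> - A"
      "\<And>z. z \<in> \<H> - A - K \<Longrightarrow> cmod z \<le> R0 \<Longrightarrow> Im (g z) < e" by blast
    have "- e < Im (z - g z)" if "z \<in> \<H> - A - K" for z
    proof (cases "cmod z \<le> R0")
      case True
      have "0 < Im z" using that by (simp add: half_plane_mem)
      then show ?thesis using K(3)[OF that True] by simp
    next
      case False
      then have "cmod (g z - z) < e" using R0(1)[of z] that by simp
      then show ?thesis using abs_Im_le_cmod[of "g z - z"] by simp
    qed
    then show "\<exists>K. compact K \<and> K \<subseteq> \<H> - A \<and> (\<forall>z\<in>\<H> - A - K. - e < Im (z - g z))"
      using K by blast
  qed
  then show ?thesis by simp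
qed

text \<open>The two maps enter asymmetrically: near the finite boundary \<open>g\<close> must have
  small imaginary part, while for \<open>g'\<close> positivity is enough. Exchanging them gives
  equality.\<close>

lemma hydrodynamic_map_Im_le_other:
  assumes A: "half_plane_hull A" and g: "hydrodynamic_map A g" and g': "hydrodynamic_map A g'"
    and z: "z \<in> \<H> - A"
  shows "Im (g z) \<le> Im (g' z)"
proof -
  have conf: "conformal_onto g (\<H> - A) \<H>" "conformal_onto g' (\<H> - A) \<H>"
    using g g' by (simp_all add: hydrodynamic_map_def)
  have opn: "open (\<H> - A)" "connected (\<H> - A)" using A by (auto simp: half_plane_hull_def region_def)
  have "0 \<le> Im (g' z - g z)"
  proof (rule Im_nonneg_maximum_principle[OF _ opn _ z])
    show "(\<lambda>z. g' z - g z) holomorphic_on \<H> - A"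
      by (intro holomorphic_intros conformal_onto_holomorphic[OF conf(1)] conformal_onto_holomorphic[OF conf(2)])
    fix e :: real assume e: "0 < e"
    then have e2: "0 < e / 2" by simp
    obtain R1 where R1: "\<And>z. z \<in> \<H> - A \<Longrightarrow> R1 \<le> cmod z \<Longrightarrow> cmod (g z - z) < e / 2"
      "\<And>R. R1 \<le> R \<Longrightarrow> \<exists>K. compact K \<and> K \<subseteq> \<H> - A \<and> (\<forall>z\<in>\<H> - A - K. cmod z \<le> R \<longrightarrow> Im (g z) < e / 2)"
      using hydrodynamic_map_boundary[OF A g e2] by metis
    obtain R2 where R2: "\<And>z. z \<in> \<H> - A \<Longrightarrow> R2 \<le> cmod z \<Longrightarrow> cmod (g' z - z) < e / 2"
      using hydrodynamic_map_boundary[OF A g' e2] by metis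
    define R where "R = max R1 R2"
    obtain K where K: "compact K" "K \<subseteq> \<H> - A"
      "\<And>z. z \<in> \<H> - A - K \<Longrightarrow> cmod z \<le> R \<Longrightarrow> Im (g z) < e / 2"
      using R1(2)[of R] by (auto simp: R_def)
    have "- e < Im (g' z - g z)" if z: "z \<in> \<H> - A - K" for z
    proof (cases "cmod z \<le> R")
      case True
      have "0 < Im (g' z)" using conformal_onto_mem[OF conf(2), of z] z by (simp add: half_plane_mem)
      then show ?thesis using K(3)[OF z True] e by simp
    next
      case False
      then have "cmod (g z - z) < e / 2" "cmod (g' z - z) < e / 2"
        using R1(1)[of z] R2[of z] z by (auto simp: R_def)
      then show ?thesis
        using abs_Im_le_cmod[of "g z - z"] abs_Im_le_cmod[of "g' z - z"] by (simp add: abs_le_iff)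
    qed
    then show "\<exists>K. compact K \<and> K \<subseteq> \<H> - A \<and> (\<forall>z\<in>\<H> - A - K. - e < Im (g' z - g z))"
      using K by blast
  qed
  then show ?thesis by simp
qed

lemma hydrodynamic_map_unique:
  assumes A: "half_plane_hull A" and g: "hydrodynamic_map A g" and g': "hydrodynamic_map A g'"
    and z: "z \<in> \<H> - A"
  shows "g z = g' z"
proof -
  have conf: "conformal_onto g (\<H> - A) \<H>" "conformal_onto g' (\<H> - A) \<H>"
    using g g' by (simp_all add: hydrodynamic_map_def)
  have opn: "open (\<H> - A)" "connected (\<H> - A)" using A by (auto simp: half_plane_hull_def region_def)
  have Im_eq: "Im (g z - g' z) = 0" if "z \<in> \<H> - A" for z
    using hydrodynamic_map_Im_le_other[OF A g g' that] hydrodynamic_map_Im_le_other[OF A g' g that]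
    by simp
  have hol: "(\<lambda>z. g z - g' z) holomorphic_on \<H> - A"
    by (intro holomorphic_intros conformal_onto_holomorphic[OF conf(1)] conformal_onto_holomorphic[OF conf(2)])
  \<comment> \<open>A nonconstant difference would have open image, but its image lies on the real
    line.\<close>
  have "(\<lambda>z. g z - g' z) constant_on \<H> - A"
  proof (rule ccontr)
    assume "\<not> ?thesis"
    then have "open ((\<lambda>z. g z - g' z) ` (\<H> - A))"
      by (rule open_mapping_thm[OF hol opn opn(1) order_refl])
    moreover have "g z - g' z \<in> (\<lambda>z. g z - g' z) ` (\<H> - A)" using z by blast
    ultimately obtain d where d: "0 < d" "ball (g z - g' z) d \<subseteq> (\<lambda>z. g z - g' z) ` (\<H> - A)"
      by (meson openE)
    have "g z - g' z + \<i> * of_real (d / 2) \<in> ball (g z - g' z) d"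
      using d by (simp add: dist_norm norm_mult)
    then obtain v where "v \<in> \<H> - A" "g z - g' z + \<i> * of_real (d / 2) = g v - g' v"
      using d(2) by blast
    then have "Im (g z - g' z + \<i> * of_real (d / 2)) = 0" using Im_eq[of v] by simp
    then show False using Im_eq[OF z] d by simp
  qed
  then obtain c where c: "\<And>z. z \<in> \<H> - A \<Longrightarrow> g z - g' z = c"
    unfolding constant_on_def by blast
  have "c = 0"
  proof (rule ccontr)
    assume "c \<noteq> 0"
    then have e: "0 < cmod c / 2" by simp
    obtain R1 where R1: "\<And>z. z \<in> \<H> - A \<Longrightarrow> R1 \<le> cmod z \<Longrightarrow> cmod (g z - z) < cmod c / 2"
      using hydrodynamic_map_boundary[OF A g e] by metis
    obtain R2 where R2: "\<And>z. z \<in> \<H> - A \<Longrightarrow> R2 \<le> cmod z \<Longrightarrow> cmod (g' z - z) < cmod c / 2"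
      using hydrodynamic_map_boundary[OF A g' e] by metis
    obtain R3 where R3: "0 < R3" "\<And>z. z \<in> A \<Longrightarrow> cmod z < R3"
      using half_plane_hull_bounded[OF A] by metis
    define v where "v = \<i> * complex_of_real (max R3 (max R1 R2))"
    have v: "v \<in> \<H>" "cmod v = max R3 (max R1 R2)" using R3 by (auto simp: v_def half_plane_mem norm_mult)
    then have vA: "v \<in> \<H> - A" using R3(2)[of v] by auto
    have "cmod (g v - v) < cmod c / 2" "cmod (g' v - v) < cmod c / 2"
      using R1[OF vA] R2[OF vA] v by auto
    moreover have "cmod (g v - g' v) \<le> cmod (g v - v) + cmod (g' v - v)"
      using norm_triangle_ineq4[of "g v - v" "g' v - v"] by simp
    ultimately show False using c[OF vA] by simp
  qed
  with c[OF z] show ?thesis by simp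
qed

section \<open>Moebius maps and divided differences\<close>

text \<open>The real axis is the perpendicular bisector of \<open>p\<close> and
  \<open>cnj p\<close>, so the half-plane consists of the points closer to \<open>p\<close>.\<close>

lemma norm_diff_less_iff_half_plane:
  assumes "0 < Im p"
  shows "cmod (z - p) < cmod (z - cnj p) \<longleftrightarrow> 0 < Im z"
proof -
  have "(cmod (z - cnj p))\<^sup>2 - (cmod (z - p))\<^sup>2 = 4 * Im p * Im z"
    unfolding cmod_power2 by (simp add: power2_eq_square algebra_simps)
  then have "(cmod (z - p))\<^sup>2 < (cmod (z - cnj p))\<^sup>2 \<longleftrightarrow> 0 < 4 * Im p * Im z" by linarith
  moreover have "cmod (z - p) < cmod (z - cnj p) \<longleftrightarrow> (cmod (z - p))\<^sup>2 < (cmod (z - cnj p))\<^sup>2"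
    by (metis norm_ge_zero power2_less_imp_less power_strict_mono zero_less_numeral)
  ultimately show ?thesis
    using assms by (simp add: zero_less_mult_iff)
qed

lemma half_plane_disk_inverse_Moebius:
  assumes p: "0 < Im p" and \<zeta>: "cmod \<zeta> < 1"
  shows "0 < Im ((p - cnj p * \<zeta>) / (1 - \<zeta>))"
    and "((p - cnj p * \<zeta>) / (1 - \<zeta>) - p) / ((p - cnj p * \<zeta>) / (1 - \<zeta>) - cnj p) = \<zeta>"
proof -
  define v where "v = (p - cnj p * \<zeta>) / (1 - \<zeta>)"
  have \<zeta>1: "1 - \<zeta> \<noteq> 0" using \<zeta> by auto
  have pp: "p - cnj p \<noteq> 0" using p by (auto simp: complex_eq_iff)
  have v: "v - p = \<zeta> * (v - cnj p)" "v - cnj p = (p - cnj p) / (1 - \<zeta>)"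
    unfolding v_def using \<zeta>1 by (simp_all add: field_simps)
  have "v - cnj p \<noteq> 0" using v(2) pp \<zeta>1 by simp
  then have "cmod (v - p) < cmod (v - cnj p)"
    unfolding v(1) using \<zeta> by (simp add: norm_mult)
  then show "0 < Im v" using norm_diff_less_iff_half_plane[OF p] by blast
  show "(v - p) / (v - cnj p) = \<zeta>"
    unfolding v(1) using \<open>v - cnj p \<noteq> 0\<close> by simp
qed

lemma conformal_onto_half_plane_disk:
  assumes p: "0 < Im p"
  shows "conformal_onto (\<lambda>z. (z - p) / (z - cnj p)) \<H> \<D>"
    and "conformal_onto (\<lambda>\<zeta>. (p - cnj p * \<zeta>) / (1 - \<zeta>)) \<D> \<H>"
proof -
  have ne: "z - cnj p \<noteq> 0" if "z \<in> \<H>" for z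
    using that p by (auto simp: half_plane_mem complex_eq_iff)
  have hol1: "(\<lambda>z. (z - p) / (z - cnj p)) holomorphic_on \<H>"
    by (intro holomorphic_intros) (use ne in auto)
  have hol2: "(\<lambda>\<zeta>. (p - cnj p * \<zeta>) / (1 - \<zeta>)) holomorphic_on \<D>"
    by (intro holomorphic_intros) auto
  have map1: "(z - p) / (z - cnj p) \<in> \<D>" if "z \<in> \<H>" for z
    using norm_diff_less_iff_half_plane[OF p, of z] that ne[OF that]
    by (simp add: half_plane_mem norm_divide)
  have map2: "(p - cnj p * \<zeta>) / (1 - \<zeta>) \<in> \<H>" if "\<zeta> \<in> \<D>" for \<zeta>
    using half_plane_disk_inverse_Moebius(1)[OF p, of \<zeta>] that by (simp add: half_plane_mem)
  have inv1: "(p - cnj p * ((z - p) / (z - cnj p))) / (1 - (z - p) / (z - cnj p)) = z" if "z \<in> \<H>" for z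
  proof -
    define d where "d = z - cnj p"
    have d: "d \<noteq> 0" "z = d + cnj p" using ne[OF that] by (auto simp: d_def)
    have pp: "p - cnj p \<noteq> 0" using p by (auto simp: complex_eq_iff)
    have "1 - (z - p) / d = (p - cnj p) / d"
      "p - cnj p * ((z - p) / d) = (p - cnj p) / d * z"
      using d by (simp_all add: field_simps)
    then show ?thesis using pp d(1) unfolding d_def[symmetric] by simp
  qed
  have inv2: "((p - cnj p * \<zeta>) / (1 - \<zeta>) - p) / ((p - cnj p * \<zeta>) / (1 - \<zeta>) - cnj p) = \<zeta>" if "\<zeta> \<in> \<D>" for \<zeta>
    using half_plane_disk_inverse_Moebius(2)[OF p, of \<zeta>] that by simp
  show "conformal_onto (\<lambda>z. (z - p) / (z - cnj p)) \<H> \<D>"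
    by (rule conformal_ontoI[OF hol1 hol2 map1 map2 inv1 inv2])
  show "conformal_onto (\<lambda>\<zeta>. (p - cnj p * \<zeta>) / (1 - \<zeta>)) \<D> \<H>"
    by (rule conformal_ontoI[OF hol2 hol1 map2 map1 inv2 inv1])
qed

lemma conformal_onto_affine_half_plane:
  assumes "0 < a"
  shows "conformal_onto (\<lambda>z. (z + of_real b) / of_real a) \<H> \<H>"
  by (rule conformal_ontoI[of _ _ "\<lambda>z. of_real a * z - of_real b"])
    (use assms in \<open>auto intro!: holomorphic_intros simp: half_plane_mem field_simps\<close>)

lemma conformal_onto_rotation:
  assumes "cmod c = 1"
  shows "conformal_onto (\<lambda>z. z / c) \<D> \<D>"
proof -
  have "c \<noteq> 0" using assms by auto
  then show ?thesis
    by (intro conformal_ontoI[of _ _ "\<lambda>z. c * z"])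
      (use assms in \<open>auto intro!: holomorphic_intros simp: norm_divide norm_mult\<close>)
qed

lemma isCont_holomorphic_on_ball:
  assumes "f holomorphic_on ball w r" "0 < r"
  shows "isCont f w"
  by (rule field_differentiable_imp_continuous_at, rule holomorphic_on_imp_differentiable_at[OF assms(1)])
    (use assms in auto)

text \<open>Removing one Taylor term keeps the function real on the axis, so iteration shows that
  successive coefficients are real. At 0 reality follows by a limit along positive reals.\<close>

lemma real_divided_difference:
  assumes f: "f holomorphic_on ball 0 r" and r: "0 < r"
    and real: "\<And>w. w \<in> ball 0 r \<Longrightarrow> Im w = 0 \<Longrightarrow> Im (f w) = 0"
  obtains h where "h holomorphic_on ball 0 r" "\<And>w. w \<in> ball 0 r \<Longrightarrow> f w = f 0 + w * h w"
    "\<And>w. w \<in> ball 0 r \<Longrightarrow> Im w = 0 \<Longrightarrow> Im (h w) = 0" "h 0 = deriv f 0"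
proof -
  define h where "h w = (if w = 0 then deriv f 0 else (f w - f 0) / w)" for w
  have der: "deriv (\<lambda>w. f w - f 0) 0 = deriv f 0"
    by (rule DERIV_imp_deriv) (rule derivative_eq_intros holomorphic_derivI[OF f] refl | use r in simp)+
  have holh: "h holomorphic_on ball 0 r"
    by (rule pole_theorem_open_0[of "\<lambda>w. f w - f 0" _ 0])
      (use der in \<open>auto intro!: holomorphic_intros f simp: h_def\<close>)
  have nonzero: "Im (h w) = 0" if "w \<in> ball 0 r" "Im w = 0" "w \<noteq> 0" for w
    using that real[of w] real[of 0] r by (simp add: h_def Im_divide)
  have "Im (h 0) = 0"
  proof (rule tendsto_unique[of "at_right (0::real)"])
    have "((\<lambda>t. h (of_real t)) \<longlongrightarrow> h 0) (at_right 0)"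
      by (rule isCont_tendsto_compose[OF isCont_holomorphic_on_ball[OF holh r]])
        (auto intro!: tendsto_eq_intros)
    then show "((\<lambda>t. Im (h (of_real t))) \<longlongrightarrow> Im (h 0)) (at_right 0)" by (rule tendsto_Im)
    have "\<forall>\<^sub>F t in at_right 0. Im (h (of_real t)) = 0"
      unfolding eventually_at_right_field
      by (rule exI[of _ r]) (use r nonzero in auto)
    then show "((\<lambda>t. Im (h (of_real t))) \<longlongrightarrow> 0) (at_right 0)"
      by (rule tendsto_eventually)
  qed simp
  with nonzero have "Im (h w) = 0" if "w \<in> ball 0 r" "Im w = 0" for w
    using that by (cases "w = 0") auto
  then show thesis
    by (intro that[of h]) (use holh in \<open>auto simp: h_def\<close>)
qed

lemma half_plane_hull_Riemann_map:
  assumes A: "half_plane_hull A"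
  obtains \<psi> where "conformal_onto \<psi> (\<H> - A) \<D>"
proof -
  have "open (\<H> - A)" "simply_connected (\<H> - A)" "\<H> - A \<noteq> {}"
    using A by (auto simp: half_plane_hull_def region_def)
  moreover have "\<H> - A \<noteq> UNIV"
  proof -
    have "0 \<notin> \<H> - A" by (simp add: half_plane_mem)
    then show ?thesis by blast
  qed
  ultimately obtain f g where fg: "f holomorphic_on \<H> - A" "g holomorphic_on \<D>"
    "\<And>z. z \<in> \<H> - A \<Longrightarrow> f z \<in> \<D> \<and> g (f z) = z"
    "\<And>z. z \<in> \<D> \<Longrightarrow> g z \<in> \<H> - A \<and> f (g z) = z"
    using simply_connected_eq_biholomorphic_to_disc[of "\<H> - A"] by blast
  show thesis
    by (rule that[of f], rule conformal_ontoI[of _ _ g]) (use fg in blast)+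
qed

subsection \<open>Expansion at infinity\<close>

lemma compact_half_plane_Im_bound:
  assumes "compact K" "K \<subseteq> \<H>"
  obtains d where "0 < d" "\<And>z. z \<in> K \<Longrightarrow> d \<le> Im z"
proof (cases "K = {}")
  case True
  then show thesis using that[of 1] by simp
next
  case False
  have "continuous_on K Im" by (intro continuous_intros)
  then obtain m where "m \<in> K" "\<And>z. z \<in> K \<Longrightarrow> Im m \<le> Im z"
    using continuous_attains_inf[OF assms(1) False] by blast
  then show thesis using that[of "Im m"] assms(2) by (auto simp: half_plane_mem)
qed

lemma compact_minus_inverse:
  assumes K: "compact K" "K \<subseteq> \<H>"
  shows "compact ((\<lambda>z. - 1 / z) ` K)" "(\<lambda>z. - 1 / z) ` K \<subseteq> \<H>"
proof -
  show "compact ((\<lambda>z. - 1 / z) ` K)"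
    by (rule compact_continuous_image[OF _ K(1)], intro continuous_intros)
      (use K(2) in \<open>auto simp: half_plane_mem\<close>)
  show "(\<lambda>z. - 1 / z) ` K \<subseteq> \<H>"
    using K(2) minus_inverse_half_plane by blast
qed

text \<open>Taking a logarithm converts modulus 1 on the boundary into imaginary part 0, the form
  that reflection handles. A half-disk around w = 0 small enough to avoid the hull has only the real
  axis as nearby boundary.\<close>

lemma Riemann_map_log_at_infinity:
  assumes A: "half_plane_hull A" and \<psi>: "conformal_onto \<psi> (\<H> - A) \<D>"
  obtains G s where "0 < s" "G holomorphic_on ball 0 s"
    "\<And>w. w \<in> ball 0 s \<Longrightarrow> 0 < Im w \<Longrightarrow> - 1 / w \<in> \<H> - A \<and> \<psi> (- 1 / w) = exp (\<i> * G w)"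
    "\<And>w. w \<in> ball 0 s \<Longrightarrow> Im w = 0 \<Longrightarrow> Im (G w) = 0"
proof -
  obtain R where R: "0 < R" "\<And>z. z \<in> A \<Longrightarrow> cmod z < R"
    using half_plane_hull_bounded[OF A] by metis
  define K where "K t = {z \<in> \<H> - A. \<psi> z \<in> cball 0 t}" for t
  have compK: "compact (K t)" "K t \<subseteq> \<H>" if "t < 1" for t
  proof -
    show "compact (K t)"
      unfolding K_def by (rule conformal_onto_compact_preimage[OF \<psi>]) (use that in auto)
    show "K t \<subseteq> \<H>" by (auto simp: K_def)
  qed
  have "compact (K (1/2))" by (rule compK) simp
  then obtain R' where R': "0 < R'" "\<And>z. z \<in> K (1/2) \<Longrightarrow> cmod z < R'"
    using compact_imp_bounded bounded_pos_less by metis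
  \<comment> \<open>Then - 1 / w lies beyond the hull and beyond the compact set where
    \<open>\<psi>\<close> has modulus at most 1/2; a logarithm exists and \<open>Im F\<close> is
    bounded by ln 2.\<close>
  define r where "r = 1 / max R R'"
  have r: "0 < r" using R by (simp add: r_def)
  define S where "S = {w. cmod w < r \<and> 0 < Im w}"
  have S_ball: "S = ball 0 r \<inter> {w. 0 < Im w}" by (auto simp: S_def)
  have large: "max R R' < cmod (- 1 / w)" if "w \<in> S" for w
  proof -
    have "0 < cmod w" "cmod w * max R R' < 1"
      using that R by (auto simp: S_def r_def field_simps)
    then have "max R R' < 1 / cmod w" by (simp only: pos_less_divide_eq mult.commute)
    then show ?thesis by (simp add: norm_divide)
  qed
  have dom: "- 1 / w \<in> \<H> - A" if "w \<in> S" for w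
    using minus_inverse_half_plane[of w] large[OF that] R(2)[of "- 1 / w"] that
    by (auto simp: S_def half_plane_mem)
  have norm_gt: "1 / 2 < cmod (\<psi> (- 1 / w))" if "w \<in> S" for w
  proof (rule ccontr)
    assume "\<not> ?thesis"
    then have "- 1 / w \<in> K (1/2)" using dom[OF that] by (auto simp: K_def)
    with R'(2) large[OF that] show False by fastforce
  qed
  have norm_lt: "cmod (\<psi> (- 1 / w)) < 1" if "w \<in> S" for w
    using conformal_onto_mem[OF \<psi> dom[OF that]] by simp
  have hol: "(\<lambda>w. \<psi> (- 1 / w)) holomorphic_on S"
    by (rule holomorphic_on_compose_gen[OF _ conformal_onto_holomorphic[OF \<psi>], unfolded o_def])
      (use dom in \<open>auto intro!: holomorphic_intros simp: S_def\<close>)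
  have "contractible S"
    unfolding S_ball
    by (intro convex_imp_contractible convex_Int convex_ball convex_halfspace_Im_gt)
  moreover have "\<psi> (- 1 / w) \<noteq> 0" if "w \<in> S" for w
    using norm_gt[OF that] by auto
  ultimately obtain L where L: "L holomorphic_on S" "\<And>w. w \<in> S \<Longrightarrow> \<psi> (- 1 / w) = exp (L w)"
    using contractible_imp_holomorphic_log[OF hol] by metis
  define F where "F w = - \<i> * L w" for w
  have expF: "\<psi> (- 1 / w) = exp (\<i> * F w)" if "w \<in> S" for w
    using L(2)[OF that] by (simp add: F_def mult.assoc[symmetric])
  have norm_exp: "cmod (\<psi> (- 1 / w)) = exp (- Im (F w))" if "w \<in> S" for w
    using expF[OF that] by simp
  have Im_pos: "0 < Im (F w)" if "w \<in> S" for w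
    using norm_lt[OF that] norm_exp[OF that] by simp
  have Im_small: "Im (F w) < e" if "w \<in> S" "exp (- e) < cmod (\<psi> (- 1 / w))" for w e
    using that norm_exp[OF that(1)] by simp
  have "exp (- ln 2) = (1 / 2 :: real)" by (simp add: exp_minus)
  then have bd: "\<bar>Im (F w)\<bar> \<le> ln 2" if "w \<in> S" for w
    using Im_pos[OF that] Im_small[OF that, of "ln 2"] norm_gt[OF that] by simp
  have lim: "\<exists>d>0. \<forall>w\<in>S. Im w < d \<longrightarrow> \<bar>Im (F w)\<bar> \<le> e" if e: "0 < e" for e
  proof -
    have "exp (- e) < 1" using e by simp
    then have cK: "compact (K (exp (- e)))" "K (exp (- e)) \<subseteq> \<H>" by (rule compK)+
    \<comment> \<open>Points with \<open>Im F\<close> at least \<open>e\<close> lie, in the w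
      coordinate, in a compact subset of the open half-plane, hence at a positive height
      \<open>d\<close>.\<close>
    obtain d where d: "0 < d" "\<And>z. z \<in> (\<lambda>z. - 1 / z) ` K (exp (- e)) \<Longrightarrow> d \<le> Im z"
      using compact_half_plane_Im_bound[OF compact_minus_inverse[OF cK]] by metis
    have "\<bar>Im (F w)\<bar> \<le> e" if w: "w \<in> S" "Im w < d" for w
    proof -
      have "- 1 / w \<notin> K (exp (- e))"
      proof
        assume "- 1 / w \<in> K (exp (- e))"
        then have "- 1 / (- 1 / w) \<in> (\<lambda>z. - 1 / z) ` K (exp (- e))" by (rule imageI)
        then show False using d(2)[of w] w by simp
      qed
      then have "exp (- e) < cmod (\<psi> (- 1 / w))" using dom[OF w(1)] by (auto simp: K_def)
      then show ?thesis using Im_small[OF w(1)] Im_pos[OF w(1)] by fastforce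
    qed
    then show ?thesis using d(1) by blast
  qed
  have holF: "F holomorphic_on S"
    unfolding F_def by (intro holomorphic_intros L)
  obtain G s where G: "0 < s" "s \<le> r" "G holomorphic_on ball 0 s"
    "\<And>w. w \<in> ball 0 s \<Longrightarrow> 0 < Im w \<Longrightarrow> G w = F w"
    "\<And>w. w \<in> ball 0 s \<Longrightarrow> Im w = 0 \<Longrightarrow> Im (G w) = 0"
    using Schwarz_reflection_Im[OF holF[unfolded S_def] r bd[unfolded S_def] lim[unfolded S_def]]
    by metis
  show thesis
  proof (rule that[OF G(1,3)])
    fix w :: complex assume w: "w \<in> ball 0 s" "0 < Im w"
    then have "w \<in> S" using G(2) by (simp add: S_def)
    then show "- 1 / w \<in> \<H> - A \<and> \<psi> (- 1 / w) = exp (\<i> * G w)"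
      using dom expF G(4)[OF w] by simp
  qed (rule G(5))
qed

text \<open>Any conformal map onto the half-plane that sends infinity to infinity has a simple pole
  at w = 0 with real coefficients. Their reality is decisive: only a real affine map with positive
  scale, which preserves the half-plane, is then required to normalize it.\<close>

lemma hydrodynamic_map_exists:
  assumes A: "half_plane_hull A"
  obtains g k r where "hydrodynamic_map A g" "0 < r" "k holomorphic_on ball 0 r" "k 0 = 0"
    "\<And>w. w \<in> ball 0 r \<Longrightarrow> 0 < Im w \<Longrightarrow> - 1 / w \<in> \<H> - A \<and> g (- 1 / w) = - 1 / w - k w"
proof -
  obtain \<psi> where \<psi>: "conformal_onto \<psi> (\<H> - A) \<D>"
    using half_plane_hull_Riemann_map[OF A] by metis
  obtain G s where s: "0 < s" and G: "G holomorphic_on ball 0 s"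
    "\<And>w. w \<in> ball 0 s \<Longrightarrow> 0 < Im w \<Longrightarrow> - 1 / w \<in> \<H> - A \<and> \<psi> (- 1 / w) = exp (\<i> * G w)"
    "\<And>w. w \<in> ball 0 s \<Longrightarrow> Im w = 0 \<Longrightarrow> Im (G w) = 0"
    using Riemann_map_log_at_infinity[OF A \<psi>] by metis
  \<comment> \<open>The boundary value of the Riemann map at infinity; it has modulus 1 because
    \<open>G 0\<close> is real. Dividing by it moves this value to 1.\<close>
  define c where "c = exp (\<i> * G 0)"
  have c: "cmod c = 1" using G(3)[of 0] s by (simp add: c_def)
  then have c0: "c \<noteq> 0" by auto
  define E where "E w = exp (\<i> * G w) / c" for w
  have holE: "E holomorphic_on ball 0 s"
    unfolding E_def by (intro holomorphic_intros G) (use c0 in auto)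
  have E0: "E 0 = 1" using c0 by (simp add: E_def c_def)
  have E_upper: "cmod (E w) < 1" if "w \<in> ball 0 s" "0 < Im w" for w
    using conformal_onto_mem[OF \<psi>, of "- 1 / w"] G(2)[OF that] c
    by (simp add: E_def norm_divide)
  have E_real: "cmod (E w) = 1" if "w \<in> ball 0 s" "Im w = 0" for w
    using G(3)[OF that] c by (simp add: E_def norm_divide)
  have "isCont E 0"
    using isCont_holomorphic_on_ball[OF holE s] .
  then have "\<forall>\<^sub>F w in at 0. dist (E w) 1 < 1"
    using E0 tendstoD[of E 1 "at 0" 1] by (simp add: isCont_def)
  then obtain s1 where s1: "0 < s1" "\<And>w. w \<noteq> 0 \<Longrightarrow> cmod w < s1 \<Longrightarrow> dist (E w) 1 < 1"
    by (auto simp: eventually_at)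
  define t where "t = min s s1"
  have t: "0 < t" "t \<le> s" using s s1 by (auto simp: t_def)
  have E_ne: "1 + E w \<noteq> 0" if "w \<in> ball 0 t" for w
  proof
    assume "1 + E w = 0"
    then have "E w = - 1" by (simp add: add_eq_0_iff)
    moreover have "dist (E w) 1 < 1" using that s1 E0 by (cases "w = 0") (auto simp: t_def)
    ultimately show False by (simp add: dist_norm)
  qed
  \<comment> \<open>A Moebius map from disk to half-plane with 1 going to 0. Its negative reciprocal
    is \<open>m (E w)\<close>, which sends 1 to infinity, so the pole is studied as a zero.\<close>
  define \<kappa> where "\<kappa> w = \<i> * (1 - E w) / (1 + E w)" for w
  have hol\<kappa>: "\<kappa> holomorphic_on ball 0 t"
    unfolding \<kappa>_def
    by (intro holomorphic_intros holomorphic_on_subset[OF holE]) (use t E_ne in auto)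
  have Im\<kappa>: "Im (\<kappa> w) = (1 - (cmod (E w))\<^sup>2) / (cmod (1 + E w))\<^sup>2" for w
    unfolding \<kappa>_def by (simp add: Im_divide cmod_power2) (simp add: power2_eq_square algebra_simps)
  have \<kappa>_upper: "0 < Im (\<kappa> w)" if "w \<in> ball 0 t" "0 < Im w" for w
    unfolding Im\<kappa> using E_upper[of w] E_ne[OF that(1)] that t
    by (intro divide_pos_pos) (auto simp: power_less_one_iff)
  have \<kappa>_real: "Im (\<kappa> w) = 0" if "w \<in> ball 0 t" "Im w = 0" for w
    unfolding Im\<kappa> using E_real[of w] that t by simp
  have \<kappa>0: "\<kappa> 0 = 0" using E0 by (simp add: \<kappa>_def)
  obtain a where a: "0 < a" "deriv \<kappa> 0 = of_real a"
  proof (rule boundary_Hopf[OF hol\<kappa> t(1) \<kappa>0])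
    show "0 \<le> Im (\<kappa> w)" if "w \<in> ball 0 t" "0 < Im w" for w
      using \<kappa>_upper[OF that] by simp
    show mem: "\<i> * of_real (t / 2) \<in> ball 0 t" using t by (simp add: norm_mult)
    show "\<kappa> (\<i> * of_real (t / 2)) \<noteq> 0" using \<kappa>_upper[OF mem] t by auto
  qed (use that in blast)
  obtain q where q: "q holomorphic_on ball 0 t" "\<And>w. w \<in> ball 0 t \<Longrightarrow> \<kappa> w = \<kappa> 0 + w * q w"
    "\<And>w. w \<in> ball 0 t \<Longrightarrow> Im w = 0 \<Longrightarrow> Im (q w) = 0" "q 0 = deriv \<kappa> 0"
    using real_divided_difference[OF hol\<kappa> t(1) \<kappa>_real] by metis
  have "isCont q 0"
    using isCont_holomorphic_on_ball[OF q(1) t(1)] .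
  moreover have "q 0 \<noteq> 0" using q(4) a by simp
  ultimately obtain u0 where u0: "0 < u0" "\<And>w. dist 0 w < u0 \<Longrightarrow> q w \<noteq> 0"
    using continuous_at_avoid[of 0 q 0] by metis
  define u where "u = min t u0"
  have u: "0 < u" "u \<le> t" "u \<le> u0" using t u0 by (auto simp: u_def)
  have q_ne: "q w \<noteq> 0" if "w \<in> ball 0 u" for w
    using that u u0(2)[of w] by simp
  define p where "p w = 1 / q w" for w
  have holp: "p holomorphic_on ball 0 u"
    unfolding p_def by (intro holomorphic_intros holomorphic_on_subset[OF q(1)]) (use u q_ne in auto)
  have p_real: "Im (p w) = 0" if "w \<in> ball 0 u" "Im w = 0" for w
    using q(3)[of w] that u by (simp add: p_def Im_divide)
  have p0: "p 0 = of_real (1 / a)" using q(4) a by (simp add: p_def)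
  obtain p1 where p1: "p1 holomorphic_on ball 0 u" "\<And>w. w \<in> ball 0 u \<Longrightarrow> p w = p 0 + w * p1 w"
    "\<And>w. w \<in> ball 0 u \<Longrightarrow> Im w = 0 \<Longrightarrow> Im (p1 w) = 0"
    using real_divided_difference[OF holp u(1) p_real] by metis
  obtain p2 where p2: "p2 holomorphic_on ball 0 u" "\<And>w. w \<in> ball 0 u \<Longrightarrow> p1 w = p1 0 + w * p2 w"
    using real_divided_difference[OF p1(1) u(1) p1(3)] by metis
  define b where "b = Re (p1 0)"
  have b: "p1 0 = of_real b" using p1(3)[of 0] u by (simp add: b_def complex_eq_iff)
  define m where "m \<zeta> = (\<i> - cnj \<i> * \<zeta>) / (1 - \<zeta>)" for \<zeta>
  have confm: "conformal_onto m \<D> \<H>"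
    unfolding m_def by (rule conformal_onto_half_plane_disk(2)) simp
  \<comment> \<open>Since \<open>m (E w)\<close> equals - 1 / (a w) - b - w p2(w), adding
    \<open>b\<close> and multiplying by \<open>a\<close> leaves - 1 / w minus a term vanishing at
    0.\<close>
  define g where "g z = (m (\<psi> z / c) + of_real b) / of_real (1 / a)" for z
  define k where "k w = w * p2 w * of_real a" for w
  have holk: "k holomorphic_on ball 0 u"
    unfolding k_def by (intro holomorphic_intros p2(1))
  have "conformal_onto ((\<lambda>z. (z + of_real b) / of_real (1 / a)) \<circ> (m \<circ> ((\<lambda>z. z / c) \<circ> \<psi>))) (\<H> - A) \<H>"
    by (intro conformal_onto_compose[OF _ conformal_onto_affine_half_plane] conformal_onto_compose[OF _ confm]
        conformal_onto_compose[OF \<psi> conformal_onto_rotation[OF c]]) (use a in simp)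
  then have confg: "conformal_onto g (\<H> - A) \<H>"
    by (simp add: g_def[abs_def] o_def)
  have expand: "- 1 / w \<in> \<H> - A \<and> g (- 1 / w) = - 1 / w - k w" if w: "w \<in> ball 0 u" "0 < Im w" for w
  proof -
    have w': "w \<in> ball 0 t" "w \<in> ball 0 s" "w \<noteq> 0" using w u t by auto
    have dom: "- 1 / w \<in> \<H> - A" "\<psi> (- 1 / w) / c = E w"
      using G(2)[OF w'(2) w(2)] by (simp_all add: E_def)
    have "1 - E w \<noteq> 0" using E_upper[OF w'(2) w(2)] by auto
    then have "m (E w) = - 1 / \<kappa> w"
      by (simp add: m_def \<kappa>_def field_simps)
    also have "\<dots> = - p w / w"
      using q(2)[OF w'(1)] \<kappa>0 q_ne[OF w(1)] w'(3) by (simp add: p_def)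
    also have "p w = of_real (1 / a) + w * (of_real b + w * p2 w)"
      using p1(2)[OF w(1)] p2(2)[OF w(1)] p0 b by simp
    also have "- (x + w * (of_real b + w * p2 w)) / w = - (x / w) - of_real b - w * p2 w" for x
      using w'(3) by (simp add: field_simps)
    finally have "g (- 1 / w) = - 1 / w - k w"
      unfolding g_def dom(2) using a(1) w'(3) by (simp add: k_def left_diff_distrib)
    then show ?thesis using dom(1) by simp
  qed
  have big: "(\<lambda>z. g z - z) \<in> O[hull_at_infinity A](\<lambda>z. 1 / z)"
  proof -
    have "continuous_on (cball 0 (u / 2)) p2"
      using p2(1) u by (intro holomorphic_on_imp_continuous_on holomorphic_on_subset[OF p2(1)]) auto
    then have "bounded (p2 ` cball 0 (u / 2))"
      by (intro compact_imp_bounded compact_continuous_image) auto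
    then obtain B where "\<forall>v\<in>p2 ` cball 0 (u / 2). cmod v \<le> B"
      unfolding bounded_iff by blast
    then have B: "cmod (p2 w) \<le> B" if "cmod w \<le> u / 2" for w
      using that by auto
    show ?thesis
    proof (rule bigoI[of _ "B * a"], unfold eventually_hull_at_infinity, intro exI ballI impI)
      fix z assume z: "z \<in> \<H> - A" "2 / u \<le> cmod z"
      define w where "w = - 1 / z"
      have "z \<noteq> 0" using z by (auto simp: half_plane_mem)
      then have zw: "z = - 1 / w" "cmod w = 1 / cmod z" by (simp_all add: w_def norm_divide)
      have "0 < cmod z" using \<open>z \<noteq> 0\<close> by simp
      then have small: "cmod w \<le> u / 2" using z u by (simp add: zw(2) field_simps)
      have "0 < Im w"
        using minus_inverse_half_plane[of z] z by (simp add: w_def half_plane_mem)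
      then have "g z - z = - k w" using expand[of w] small u zw(1) by simp
      then have "cmod (g z - z) = cmod w * cmod (p2 w) * a"
        using a by (simp add: k_def norm_mult)
      also have "\<dots> \<le> cmod w * B * a"
        using B[OF small] a by (intro mult_right_mono mult_left_mono) auto
      also have "\<dots> = B * a * cmod (1 / z)" by (simp add: zw(2) norm_divide)
      finally show "cmod (g z - z) \<le> B * a * cmod (1 / z)" .
    qed
  qed
  show thesis
    by (rule that[of g u k]) (use confg big u holk expand in \<open>auto simp: hydrodynamic_map_def k_def\<close>)
qed

subsection \<open>Conformal radius and capacity asymptotics\<close>

lemma conformal_onto_subset:
  assumes f: "conformal_onto f D E" and S: "S \<subseteq> D"
  shows "conformal_onto f S (f ` S)"
proof -
  obtain g where g: "conformal_onto g E D" "\<And>z. z \<in> D \<Longrightarrow> g (f z) = z"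
    "\<And>w. w \<in> E \<Longrightarrow> f (g w) = w"
    using conformal_onto_inverse[OF f] by metis
  have "f ` S \<subseteq> E" using conformal_onto_mem[OF f] S by blast
  show ?thesis
  proof (rule conformal_ontoI[of _ _ g])
    show "f holomorphic_on S" "g holomorphic_on f ` S"
      using conformal_onto_holomorphic[OF f] conformal_onto_holomorphic[OF g(1)] S \<open>f ` S \<subseteq> E\<close>
      by (auto intro: holomorphic_on_subset)
  qed (use S g(2) in auto)
qed

text \<open>The Schwarz lemma for the disk automorphism obtained from \<open>h\<close> followed by
  the inverse of \<open>f\<close>. Used in both directions, it makes the conformal radius well
  defined.\<close>

lemma norm_deriv_conformal_le:
  assumes f: "conformal_onto f \<D> D" and h: "conformal_onto h \<D> D" and eq: "f 0 = h 0"
  shows "cmod (deriv h 0) \<le> cmod (deriv f 0)"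
proof -
  obtain f' where f': "conformal_onto f' D \<D>" "\<And>z. z \<in> \<D> \<Longrightarrow> f' (f z) = z"
    "\<And>w. w \<in> D \<Longrightarrow> f (f' w) = w"
    using conformal_onto_inverse[OF f] by metis
  define q where "q = f' \<circ> h"
  have q: "conformal_onto q \<D> \<D>"
    unfolding q_def by (rule conformal_onto_compose[OF h f'(1)])
  have q0: "q 0 = 0" using f'(2)[of 0] eq by (simp add: q_def)
  have le1: "cmod (deriv q 0) \<le> 1"
    by (rule Schwarz_Lemma(2)[OF conformal_onto_holomorphic[OF q] q0, of 0])
      (use conformal_onto_mem[OF q] in auto)
  have dq: "(q has_field_derivative deriv q 0) (at 0)"
    by (rule holomorphic_derivI[OF conformal_onto_holomorphic[OF q]]) auto
  have df: "(f has_field_derivative deriv f 0) (at (q 0))"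
    unfolding q0 by (rule holomorphic_derivI[OF conformal_onto_holomorphic[OF f]]) auto
  have "((f \<circ> q) has_field_derivative deriv f 0 * deriv q 0) (at 0)"
    by (rule DERIV_chain[OF df dq])
  then have "(h has_field_derivative deriv f 0 * deriv q 0) (at 0)"
    by (rule has_field_derivative_transform_within_open[of _ _ _ \<D>])
      (use f'(3) conformal_onto_mem[OF h] in \<open>auto simp: q_def\<close>)
  then have "deriv h 0 = deriv f 0 * deriv q 0" by (rule DERIV_imp_deriv)
  then show ?thesis
    using le1 mult_left_mono[of "cmod (deriv q 0)" 1 "cmod (deriv f 0)"] by (simp add: norm_mult)
qed

lemma crad_eq:
  assumes f: "conformal_onto f \<D> D" and z: "f 0 = z"
  shows "crad D z = cmod (deriv f 0)"
  unfolding crad_def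
proof (rule the_equality)
  show "\<exists>h. conformal_onto h \<D> D \<and> h 0 = z \<and> cmod (deriv f 0) = cmod (deriv h 0)"
    using f z by blast
  fix s assume "\<exists>h. conformal_onto h \<D> D \<and> h 0 = z \<and> s = cmod (deriv h 0)"
  then obtain h where h: "conformal_onto h \<D> D" "h 0 = z" "s = cmod (deriv h 0)" by blast
  show "s = cmod (deriv f 0)"
    using norm_deriv_conformal_le[OF f h(1)] norm_deriv_conformal_le[OF h(1) f] z h by simp
qed

lemma cayley_eq: "cayley y = (\<lambda>z. (z - \<i> * of_real y) / (z - cnj (\<i> * of_real y)))"
  by (simp add: cayley_def fun_eq_iff)

text \<open>Two uniformizations are compared at i y: \<open>f\<close> composed with
  \<open>\<phi>\<close> is the Cayley map. The chain rule yields \<open>deriv f 0\<close> from the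
  derivative 1 / (2 i y) of the Cayley map and D / (2 i Im p) of \<open>\<phi>\<close>.\<close>

lemma dcap_cayley_image:
  assumes A: "A \<subseteq> \<H>" and g: "conformal_onto g (\<H> - A) \<H>" and y: "0 < y"
    and iy: "\<i> * of_real y \<notin> A" and opn: "open (\<H> - A)"
    and D: "(g has_field_derivative D) (at (\<i> * of_real y))"
  shows "D \<noteq> 0" "dcap (cayley y ` A) = - ln (Im (g (\<i> * of_real y)) / (y * cmod D))"
proof -
  define z0 where "z0 = \<i> * complex_of_real y"
  define p where "p = g z0"
  define \<phi> where "\<phi> = (\<lambda>z. (z - p) / (z - cnj p)) \<circ> g"
  have z0: "z0 \<in> \<H> - A" "0 < Im z0" using y iy by (auto simp: z0_def half_plane_mem)
  have p: "0 < Im p" using conformal_onto_mem[OF g z0(1)] by (simp add: p_def half_plane_mem)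
  have pp: "p - cnj p = 2 * \<i> * of_real (Im p)" by (simp add: complex_eq_iff)
  have pne: "p - cnj p \<noteq> 0" unfolding pp using p by (simp add: complex_eq_iff)
  have cay: "conformal_onto (cayley y) \<H> \<D>"
    unfolding cayley_eq by (rule conformal_onto_half_plane_disk(1)) (use y in simp)
  have "cayley y ` (\<H> - A) = \<D> - cayley y ` A"
    using inj_on_image_set_diff[OF conformal_onto_inj[OF cay], of \<H> A] A cay
    by (auto simp: conformal_onto_def bij_betw_def)
  then have cayA: "conformal_onto (cayley y) (\<H> - A) (\<D> - cayley y ` A)"
    using conformal_onto_subset[OF cay, of "\<H> - A"] by simp
  have \<phi>: "conformal_onto \<phi> (\<H> - A) \<D>"
    unfolding \<phi>_def by (rule conformal_onto_compose[OF g conformal_onto_half_plane_disk(1)[OF p]])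
  obtain \<phi>' where \<phi>': "conformal_onto \<phi>' \<D> (\<H> - A)" "\<And>z. z \<in> \<H> - A \<Longrightarrow> \<phi>' (\<phi> z) = z"
    "\<And>w. w \<in> \<D> \<Longrightarrow> \<phi> (\<phi>' w) = w"
    using conformal_onto_inverse[OF \<phi>] by metis
  define f where "f = cayley y \<circ> \<phi>'"
  have f: "conformal_onto f \<D> (\<D> - cayley y ` A)"
    unfolding f_def by (rule conformal_onto_compose[OF \<phi>'(1) cayA])
  have \<phi>0: "\<phi> z0 = 0" by (simp add: \<phi>_def p_def)
  have f0: "f 0 = 0"
    using \<phi>'(2)[OF z0(1)] \<phi>0 by (simp add: f_def cayley_def z0_def)
  have d\<phi>: "(\<phi> has_field_derivative D / (p - cnj p)) (at z0)"
    unfolding \<phi>_def o_def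
    by (rule derivative_eq_intros D[folded z0_def] refl)+
      (use pne in \<open>simp_all add: p_def[symmetric]\<close>)
  have df: "(f has_field_derivative deriv f 0) (at (\<phi> z0))"
    unfolding \<phi>0 by (rule holomorphic_derivI[OF conformal_onto_holomorphic[OF f]]) auto
  have "((f \<circ> \<phi>) has_field_derivative deriv f 0 * (D / (p - cnj p))) (at z0)"
    by (rule DERIV_chain[OF df d\<phi>])
  then have "(cayley y has_field_derivative deriv f 0 * (D / (p - cnj p))) (at z0)"
    by (rule has_field_derivative_transform_within_open[OF _ opn z0(1)])
      (simp add: f_def \<phi>'(2))
  moreover have "(cayley y has_field_derivative 1 / (2 * z0)) (at z0)"
    unfolding cayley_def[abs_def] z0_def
    by (rule derivative_eq_intros refl)+ (use y in \<open>auto simp: field_simps\<close>)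
  ultimately have eq: "deriv f 0 * (D / (p - cnj p)) = 1 / (2 * z0)"
    by (rule DERIV_unique)
  have "z0 \<noteq> 0" using z0 by auto
  with eq show D0: "D \<noteq> 0" by auto
  have "cmod (deriv f 0) * (cmod D / (2 * Im p)) = 1 / (2 * y)"
    using arg_cong[OF eq, of cmod] p y unfolding pp z0_def by (simp add: norm_mult norm_divide)
  then have "cmod (deriv f 0) = Im p / (y * cmod D)"
    using p y D0 by (simp add: field_simps)
  then show "dcap (cayley y ` A) = - ln (Im (g (\<i> * of_real y)) / (y * cmod D))"
    unfolding dcap_def crad_eq[OF f f0] by (simp add: p_def z0_def)
qed

text \<open>Limits along a nontrivial filter are unique, which justifies the definite description in
  \<open>hcap\<close>.\<close>

lemma hull_at_infinity_neq_bot: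
  assumes "half_plane_hull A"
  shows "hull_at_infinity A \<noteq> bot"
proof
  assume "hull_at_infinity A = bot"
  then have "eventually (\<lambda>_. False) (hull_at_infinity A)" by simp
  then obtain b where b: "\<And>z. z \<in> \<H> - A \<Longrightarrow> \<not> b \<le> cmod z"
    unfolding eventually_hull_at_infinity by blast
  obtain R where R: "0 < R" "\<And>z. z \<in> A \<Longrightarrow> cmod z < R"
    using half_plane_hull_bounded[OF assms] by metis
  define z where "z = \<i> * complex_of_real (max b R)"
  have z: "cmod z = max b R" "z \<in> \<H>" using R by (auto simp: z_def half_plane_mem norm_mult)
  then show False using b[of z] R(2)[of z] by auto
qed

text \<open>With w = - 1 / z the quantity z (g z - z) equals k(w) / w, so its limit is the
  derivative of \<open>k\<close> at 0.\<close>

lemma mapping_out_expansion: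
  assumes A: "half_plane_hull A" and ne: "A \<noteq> {}"
  obtains k r where "conformal_onto (mapping_out A) (\<H> - A) \<H>" "0 < hcap A"
    "0 < r" "k holomorphic_on ball 0 r" "k 0 = 0" "deriv k 0 = of_real (hcap A)"
    "\<And>w. w \<in> ball 0 r \<Longrightarrow> 0 < Im w \<Longrightarrow> - 1 / w \<in> \<H> - A \<and> mapping_out A (- 1 / w) = - 1 / w - k w"
proof -
  define g where "g = mapping_out A"
  obtain g' k r where g': "hydrodynamic_map A g'" and r: "0 < r"
    and k: "k holomorphic_on ball 0 r" "k 0 = 0"
    and exp': "\<And>w. w \<in> ball 0 r \<Longrightarrow> 0 < Im w \<Longrightarrow> - 1 / w \<in> \<H> - A \<and> g' (- 1 / w) = - 1 / w - k w"
    using hydrodynamic_map_exists[OF A] by metis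
  have g: "hydrodynamic_map A g"
    unfolding g_def mapping_out_def by (rule someI[of _ g'], rule g')
  then have conf: "conformal_onto g (\<H> - A) \<H>" by (simp add: hydrodynamic_map_def)
  have expand: "- 1 / w \<in> \<H> - A \<and> g (- 1 / w) = - 1 / w - k w" if "w \<in> ball 0 r" "0 < Im w" for w
    using exp'[OF that] hydrodynamic_map_unique[OF A g g'] by metis
  have opn: "open (\<H> - A)" "connected (\<H> - A)" using A by (auto simp: half_plane_hull_def region_def)
  \<comment> \<open>If \<open>k\<close> vanished, \<open>g\<close> would be the identity near
    infinity and, by analytic continuation, on the whole domain; its image would then omit the
    nonempty hull.\<close>
  have "\<exists>w0\<in>ball 0 r. k w0 \<noteq> 0"
  proof (rule ccontr)
    assume "\<not> (\<exists>w0\<in>ball 0 r. k w0 \<noteq> 0)"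
    then have k0: "k w = 0" if "w \<in> ball 0 r" for w using that by blast
    define U where "U = \<H> \<inter> - cball 0 (1 / r)"
    have U: "z \<in> \<H> - A \<and> g z = z" if "z \<in> U" for z
    proof -
      have z: "0 < Im z" "1 / r < cmod z" using that by (auto simp: U_def half_plane_mem)
      then have "z \<noteq> 0" by auto
      then have "- 1 / z \<in> ball 0 r" using z r by (simp add: norm_divide field_simps)
      moreover have "0 < Im (- 1 / z)"
        using minus_inverse_half_plane[of z] z by (simp add: half_plane_mem)
      ultimately show ?thesis using expand[of "- 1 / z"] k0 by simp
    qed
    define z1 where "z1 = \<i> * complex_of_real (1 / r + 1)"
    have "cmod z1 = 1 / r + 1" "0 < Im z1"
      unfolding z1_def norm_mult norm_of_real using r by (auto intro: add_pos_pos)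
    then have "z1 \<in> U" by (simp add: U_def half_plane_mem)
    then have "U \<noteq> {}" by blast
    have "g z = z" if "z \<in> \<H> - A" for z
    proof (rule analytic_continuation_open[of U "\<H> - A" g "\<lambda>z. z" z])
      show "open U" unfolding U_def by (intro open_Int open_half_plane) auto
      show "g holomorphic_on \<H> - A" by (rule conformal_onto_holomorphic[OF conf])
    qed (use opn U \<open>U \<noteq> {}\<close> that in \<open>auto intro: holomorphic_intros\<close>)
    then have "g ` (\<H> - A) = \<H> - A" by (metis (mono_tags) image_cong image_ident)
    moreover have "g ` (\<H> - A) = \<H>" using conf by (simp add: conformal_onto_def bij_betw_def)
    moreover have "A \<subseteq> \<H>" using A by (simp add: half_plane_hull_def)
    ultimately show False using ne by blast
  qed
  then obtain w0 where w0: "w0 \<in> ball 0 r" "k w0 \<noteq> 0" by blast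
  obtain c where c: "0 < c" "deriv k 0 = of_real c"
  proof (rule boundary_Hopf[OF k(1) r k(2) _ w0])
    fix w assume w: "w \<in> ball 0 r" "0 < Im w"
    have "k w = - 1 / w - g (- 1 / w)" using expand[OF w] by simp
    then show "0 \<le> Im (k w)"
      using hydrodynamic_map_Im_le[OF A g, of "- 1 / w"] expand[OF w] by simp
  qed (use that in blast)
  have lim: "((\<lambda>z. z * (g z - z)) \<longlongrightarrow> of_real c) (hull_at_infinity A)"
  proof -
    have "(k has_field_derivative of_real c) (at 0)"
      unfolding c(2)[symmetric] by (rule holomorphic_derivI[OF k(1)]) (use r in auto)
    then have "((\<lambda>w. k w / w) \<longlongrightarrow> of_real c) (at 0)"
      using k(2) by (simp add: has_field_derivative_iff)
    moreover have "filterlim (\<lambda>z. - 1 / z) (at 0) (hull_at_infinity A)"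
      unfolding filterlim_at
    proof
      have "((\<lambda>z::complex. - 1 / z) \<longlongrightarrow> 0) at_infinity"
        by (rule tendsto_divide_0[OF tendsto_const filterlim_ident])
      then show "((\<lambda>z. - 1 / z) \<longlongrightarrow> 0) (hull_at_infinity A)"
        unfolding hull_at_infinity_def by (rule tendsto_mono[OF inf_le1])
      show "\<forall>\<^sub>F z in hull_at_infinity A. - 1 / z \<in> UNIV \<and> - 1 / z \<noteq> 0"
        unfolding eventually_hull_at_infinity by (auto intro!: exI[of _ 1])
    qed
    ultimately have "((\<lambda>z. k (- 1 / z) / (- 1 / z)) \<longlongrightarrow> of_real c) (hull_at_infinity A)"
      by (rule filterlim_compose)
    moreover have "\<forall>\<^sub>F z in hull_at_infinity A. k (- 1 / z) / (- 1 / z) = z * (g z - z)"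
      unfolding eventually_hull_at_infinity
    proof (intro exI ballI impI)
      fix z assume z: "z \<in> \<H> - A" "1 / r + 1 \<le> cmod z"
      have "1 / r < cmod z" "z \<noteq> 0" using z by (auto simp: half_plane_mem)
      then have "- 1 / z \<in> ball 0 r" using r by (simp add: norm_divide field_simps)
      moreover have "0 < Im (- 1 / z)"
        using minus_inverse_half_plane[of z] z by (simp add: half_plane_mem)
      ultimately have "g z = z - k (- 1 / z)" using expand[of "- 1 / z"] by simp
      then show "k (- 1 / z) / (- 1 / z) = z * (g z - z)" by simp
    qed
    ultimately show ?thesis by (rule Lim_transform_eventually)
  qed
  have "hcap A = c"
    unfolding hcap_def g_def[symmetric]
  proof (rule the_equality[of _ c])
    show "((\<lambda>z. z * (g z - z)) \<longlongrightarrow> of_real c) (hull_at_infinity A)" by (rule lim)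
    fix c' assume "((\<lambda>z. z * (g z - z)) \<longlongrightarrow> complex_of_real c') (hull_at_infinity A)"
    then have "complex_of_real c' = of_real c"
      by (rule tendsto_unique[OF hull_at_infinity_neq_bot[OF A] _ lim])
    then show "c' = c" by simp
  qed
  then show thesis
    using that[of r k] conf expand r k c unfolding g_def by simp
qed

section \<open>Second-order asymptotics of the logarithms\<close>

text \<open>The hypothesis forces \<open>x\<close> to 0, and replacing ln (1 + x) by x costs at most
  2 x^2. Multiplied by y^2 this is 2 (y^2 x) x, a bounded factor times a null one.\<close>

lemma tendsto_mult_ln_one_plus:
  fixes x :: "real \<Rightarrow> real"
  assumes "((\<lambda>y. y\<^sup>2 * x y) \<longlongrightarrow> l) at_top"
  shows "((\<lambda>y. y\<^sup>2 * ln (1 + x y)) \<longlongrightarrow> l) at_top"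
proof -
  have "((\<lambda>y. y\<^sup>2 * x y * (1 / y\<^sup>2)) \<longlongrightarrow> l * 0) at_top"
    by (intro tendsto_mult assms) real_asymp
  then have "((\<lambda>y. y\<^sup>2 * x y * (1 / y\<^sup>2)) \<longlongrightarrow> 0) at_top"
    by (simp only: mult_zero_right)
  then have x0: "(x \<longlongrightarrow> 0) at_top"
  proof (rule Lim_transform_eventually)
    show "\<forall>\<^sub>F y in at_top. y\<^sup>2 * x y * (1 / y\<^sup>2) = x y"
      using eventually_gt_at_top[of 0] by eventually_elim simp
  qed
  have "((\<lambda>y. y\<^sup>2 * ln (1 + x y) - y\<^sup>2 * x y) \<longlongrightarrow> 0) at_top"
  proof (rule Lim_null_comparison)
    have "\<forall>\<^sub>F y in at_top. \<bar>x y\<bar> < 1 / 2"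
      using tendstoD[OF x0, of "1/2"] by simp
    then show "\<forall>\<^sub>F y in at_top. norm (y\<^sup>2 * ln (1 + x y) - y\<^sup>2 * x y) \<le> 2 * (y\<^sup>2 * x y) * x y"
    proof eventually_elim
      fix y assume "\<bar>x y\<bar> < 1 / 2"
      then have "\<bar>ln (1 + x y) - x y\<bar> \<le> 2 * (x y)\<^sup>2"
        by (intro abs_ln_one_plus_x_minus_x_bound) simp
      then have "y\<^sup>2 * \<bar>ln (1 + x y) - x y\<bar> \<le> y\<^sup>2 * (2 * (x y)\<^sup>2)"
        by (intro mult_left_mono) auto
      moreover have "norm (y\<^sup>2 * ln (1 + x y) - y\<^sup>2 * x y) = y\<^sup>2 * \<bar>ln (1 + x y) - x y\<bar>"
        by (simp add: abs_mult flip: right_diff_distrib)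
      ultimately show "norm (y\<^sup>2 * ln (1 + x y) - y\<^sup>2 * x y) \<le> 2 * (y\<^sup>2 * x y) * x y"
        by (simp add: power2_eq_square mult_ac)
    qed
    show "((\<lambda>y. 2 * (y\<^sup>2 * x y) * x y) \<longlongrightarrow> 0) at_top"
      using tendsto_mult[OF tendsto_mult[OF tendsto_const[of 2] assms] x0] by simp
  qed
  from tendsto_add[OF this assms] show ?thesis by simp
qed

lemma dcap_cayley_asymptotics:
  assumes A: "half_plane_hull A" and ne: "A \<noteq> {}"
  shows "((\<lambda>y. y\<^sup>2 * dcap (cayley y ` A)) \<longlongrightarrow> 2 * hcap A) at_top"
proof -
  define g where "g = mapping_out A"
  define c where "c = hcap A"
  obtain k r where conf: "conformal_onto g (\<H> - A) \<H>" and r: "0 < r"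
    and k: "k holomorphic_on ball 0 r" "k 0 = 0" "deriv k 0 = of_real c"
    and expand: "\<And>w. w \<in> ball 0 r \<Longrightarrow> 0 < Im w \<Longrightarrow> - 1 / w \<in> \<H> - A \<and> g (- 1 / w) = - 1 / w - k w"
    using mapping_out_expansion[OF A ne] unfolding g_def c_def by metis
  have opn: "open (\<H> - A)" using A by (auto simp: half_plane_hull_def region_def)
  have AH: "A \<subseteq> \<H>" using A by (simp add: half_plane_hull_def)
  define v where "v y = \<i> / complex_of_real y" for y
  have v_lim: "filterlim v (at 0) at_top"
    unfolding filterlim_at
  proof
    show "(v \<longlongrightarrow> 0) at_top"
      unfolding v_def
      by (rule tendsto_divide_0[OF tendsto_const filterlim_of_real_at_infinity])
    show "\<forall>\<^sub>F y in at_top. v y \<in> UNIV \<and> v y \<noteq> 0"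
      using eventually_gt_at_top[of 0] by eventually_elim (simp add: v_def)
  qed
  \<comment> \<open>The derivative of z - k (- 1 / z) is 1 - k' (- 1 / z) / z^2; at z = i y the
    square is - y^2, which turns the minus into a plus.\<close>
  define \<beta> where "\<beta> y = deriv k (v y) / (of_real y)\<^sup>2" for y
  \<comment> \<open>The excess of the squared modulus of 1 + \<open>\<beta> y\<close> over 1.
    Squaring gives a real logarithm at the price of the factor 1/2 in \<open>main\<close>.\<close>
  define x1 where "x1 y = 2 * Re (\<beta> y) + (cmod (\<beta> y))\<^sup>2" for y
  \<comment> \<open>Here 1 + \<open>x2 y\<close> is Im (g (i y)) / y.\<close>
  define x2 where "x2 y = - Im (k (v y)) / y" for y
  have v_dom: "v y \<in> ball 0 r \<and> 0 < Im (v y) \<and> - 1 / v y = \<i> * of_real y" if "1 / r < y" for y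
  proof -
    have "0 < 1 / r" using r by simp
    then have "0 < y" using that by linarith
    then show ?thesis using that r by (simp add: v_def norm_divide field_simps)
  qed
  have main: "y\<^sup>2 * dcap (cayley y ` A) = y\<^sup>2 * ln (1 + x1 y) / 2 - y\<^sup>2 * ln (1 + x2 y)"
    if y: "1 / r < y" for y
  proof -
    have "0 < 1 / r" using r by simp
    then have y0: "0 < y" using y by linarith
    define z0 where "z0 = \<i> * complex_of_real y"
    have v: "v y \<in> ball 0 r" "0 < Im (v y)" "- 1 / v y = z0" "v y = - 1 / z0"
      using v_dom[OF y] y0 by (auto simp: z0_def v_def field_simps)
    have z0: "z0 \<in> \<H> - A" "g z0 = z0 - k (v y)" using expand[OF v(1,2)] v(3) by auto
    have "z0 \<noteq> 0" using y0 by (simp add: z0_def)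
    have dk: "(k has_field_derivative deriv k (v y)) (at (- 1 / z0))"
      unfolding v(4)[symmetric] by (rule holomorphic_derivI[OF k(1) open_ball v(1)])
    have "((\<lambda>z. z - k (- 1 / z)) has_field_derivative 1 - deriv k (v y) * (1 / z0\<^sup>2)) (at z0)"
      by (rule derivative_eq_intros DERIV_chain2[where f = k and g = "\<lambda>z. - 1 / z", OF dk] refl)+
        (use \<open>z0 \<noteq> 0\<close> in \<open>auto simp: power2_eq_square\<close>)
    then have "(g has_field_derivative 1 - deriv k (v y) * (1 / z0\<^sup>2)) (at z0)"
    proof (rule has_field_derivative_transform_within_open)
      show "open (\<H> \<inter> - cball 0 (1 / r))" by (intro open_Int open_half_plane) auto
      show "z0 \<in> \<H> \<inter> - cball 0 (1 / r)" using y y0 by (simp add: z0_def half_plane_mem norm_mult)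
      fix z assume "z \<in> \<H> \<inter> - cball 0 (1 / r)"
      then have z: "0 < Im z" "1 / r < cmod z" "z \<noteq> 0" by (auto simp: half_plane_mem)
      then have "- 1 / z \<in> ball 0 r" using r by (simp add: norm_divide field_simps)
      moreover have "0 < Im (- 1 / z)"
        using minus_inverse_half_plane[of z] z by (simp add: half_plane_mem)
      ultimately show "z - k (- 1 / z) = g z" using expand[of "- 1 / z"] by simp
    qed
    also have "1 - deriv k (v y) * (1 / z0\<^sup>2) = 1 + \<beta> y"
      by (simp add: z0_def \<beta>_def power_mult_distrib)
    finally have dg: "(g has_field_derivative 1 + \<beta> y) (at (\<i> * of_real y))"
      by (simp add: z0_def)
    have iy: "\<i> * of_real y \<notin> A" using z0(1) by (simp add: z0_def)
    note dcap = dcap_cayley_image[OF AH conf y0 iy opn dg]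
    have "Im (g z0) = y - Im (k (v y))" unfolding z0(2) by (simp add: z0_def)
    then have Img: "Im (g z0) / y = 1 + x2 y" "0 < Im (g z0)"
      using conformal_onto_mem[OF conf z0(1)] y0
      by (simp_all add: x2_def diff_divide_distrib half_plane_mem)
    then have pos: "0 < 1 + x2 y" using y0 by (metis divide_pos_pos)
    have sq: "(cmod (1 + \<beta> y))\<^sup>2 = 1 + x1 y"
      unfolding x1_def cmod_power2 by (simp add: power2_eq_square algebra_simps)
    have "ln (1 + x1 y) = 2 * ln (cmod (1 + \<beta> y))"
      unfolding sq[symmetric] using dcap(1) by (simp add: ln_realpow)
    moreover have "dcap (cayley y ` A) = ln (cmod (1 + \<beta> y)) - ln (1 + x2 y)"
    proof -
      have "dcap (cayley y ` A) = - ln ((1 + x2 y) / cmod (1 + \<beta> y))"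
        unfolding dcap(2) Img(1)[symmetric] by (simp add: z0_def)
      then show ?thesis using pos dcap(1) by (simp add: ln_div)
    qed
    ultimately show ?thesis by (simp add: right_diff_distrib)
  qed
  have \<beta>_lim: "((\<lambda>y. (of_real y)\<^sup>2 * \<beta> y) \<longlongrightarrow> of_real c) at_top"
  proof -
    have "isCont (deriv k) 0"
      by (rule isCont_holomorphic_on_ball[OF holomorphic_deriv[OF k(1) open_ball] r])
    then have "((\<lambda>y. deriv k (v y)) \<longlongrightarrow> deriv k 0) at_top"
      by (rule isCont_tendsto_compose) (use v_lim in \<open>simp add: filterlim_at\<close>)
    moreover have "\<forall>\<^sub>F y in at_top. deriv k (v y) = (of_real y)\<^sup>2 * \<beta> y"
      using eventually_gt_at_top[of 0] by eventually_elim (simp add: \<beta>_def)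
    ultimately show ?thesis unfolding k(3) by (rule Lim_transform_eventually)
  qed
  have "((\<lambda>y. y\<^sup>2 * x1 y) \<longlongrightarrow> 2 * c) at_top"
  proof -
    have "((\<lambda>y. 2 * Re ((of_real y)\<^sup>2 * \<beta> y) + (cmod ((of_real y)\<^sup>2 * \<beta> y))\<^sup>2 * (1 / y\<^sup>2))
        \<longlongrightarrow> 2 * Re (of_real c) + (cmod (of_real c))\<^sup>2 * 0) at_top"
      by (intro tendsto_intros \<beta>_lim) real_asymp
    then have "((\<lambda>y. 2 * Re ((of_real y)\<^sup>2 * \<beta> y) + (cmod ((of_real y)\<^sup>2 * \<beta> y))\<^sup>2 * (1 / y\<^sup>2))
        \<longlongrightarrow> 2 * c) at_top" by simp
    moreover have "\<forall>\<^sub>F y in at_top.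
        2 * Re ((of_real y)\<^sup>2 * \<beta> y) + (cmod ((of_real y)\<^sup>2 * \<beta> y))\<^sup>2 * (1 / y\<^sup>2) = y\<^sup>2 * x1 y"
      using eventually_gt_at_top[of 0]
    proof eventually_elim
      fix y :: real assume y: "0 < y"
      have "Re ((of_real y)\<^sup>2 * \<beta> y) = y\<^sup>2 * Re (\<beta> y)"
        by (simp flip: of_real_power)
      moreover have "cmod ((of_real y)\<^sup>2 * \<beta> y) = y\<^sup>2 * cmod (\<beta> y)"
        by (simp add: norm_mult norm_power)
      ultimately show "2 * Re ((of_real y)\<^sup>2 * \<beta> y) + (cmod ((of_real y)\<^sup>2 * \<beta> y))\<^sup>2 * (1 / y\<^sup>2) = y\<^sup>2 * x1 y"
        using y by (simp add: x1_def power2_eq_square field_simps)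
    qed
    ultimately show ?thesis by (rule Lim_transform_eventually)
  qed
  then have l1: "((\<lambda>y. y\<^sup>2 * ln (1 + x1 y)) \<longlongrightarrow> 2 * c) at_top" by (rule tendsto_mult_ln_one_plus)
  have "((\<lambda>y. y\<^sup>2 * x2 y) \<longlongrightarrow> - c) at_top"
  proof -
    have "(k has_field_derivative of_real c) (at 0)"
      unfolding k(3)[symmetric] by (rule holomorphic_derivI[OF k(1)]) (use r in auto)
    then have "((\<lambda>w. k w / w) \<longlongrightarrow> of_real c) (at 0)"
      using k(2) by (simp add: has_field_derivative_iff)
    then have "((\<lambda>y. k (v y) / v y) \<longlongrightarrow> of_real c) at_top"
      by (rule filterlim_compose[OF _ v_lim])
    then have "((\<lambda>y. - Re (k (v y) / v y)) \<longlongrightarrow> - Re (of_real c)) at_top"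
      by (intro tendsto_intros)
    then have "((\<lambda>y. - Re (k (v y) / v y)) \<longlongrightarrow> - c) at_top" by simp
    moreover have "\<forall>\<^sub>F y in at_top. - Re (k (v y) / v y) = y\<^sup>2 * x2 y"
      using eventually_gt_at_top[of 0]
    proof eventually_elim
      fix y :: real assume y: "0 < y"
      have "k (v y) / v y = - \<i> * of_real y * k (v y)"
        using y by (simp add: v_def field_simps)
      then show "- Re (k (v y) / v y) = y\<^sup>2 * x2 y"
        using y by (simp add: x2_def power2_eq_square)
    qed
    ultimately show ?thesis by (rule Lim_transform_eventually)
  qed
  then have l2: "((\<lambda>y. y\<^sup>2 * ln (1 + x2 y)) \<longlongrightarrow> - c) at_top" by (rule tendsto_mult_ln_one_plus)
  \<comment> \<open>The derivative factor contributes 2 c / 2 and the height factor another c, which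
    together explain the constant 2.\<close>
  have "((\<lambda>y. y\<^sup>2 * ln (1 + x1 y) / 2 - y\<^sup>2 * ln (1 + x2 y)) \<longlongrightarrow> 2 * c / 2 - (- c)) at_top"
    by (intro tendsto_intros l1 l2) auto
  then have "((\<lambda>y. y\<^sup>2 * ln (1 + x1 y) / 2 - y\<^sup>2 * ln (1 + x2 y)) \<longlongrightarrow> 2 * hcap A) at_top"
    by (simp add: c_def)
  moreover have "\<forall>\<^sub>F y in at_top. y\<^sup>2 * ln (1 + x1 y) / 2 - y\<^sup>2 * ln (1 + x2 y) = y\<^sup>2 * dcap (cayley y ` A)"
    using eventually_gt_at_top[of "1 / r"] by eventually_elim (simp add: main)
  ultimately show ?thesis by (rule Lim_transform_eventually)
qed

theorem corollary2p4:
  fixes A :: "complex set" and B :: "real \<Rightarrow> complex set"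
  assumes "half_plane_hull A" and "A \<noteq> {}"
    and "\<And>y. y > 0 \<Longrightarrow> B y = cayley y ` A"
  shows "((\<lambda>y. y\<^sup>2 * dcap (B y) / hcap A) \<longlongrightarrow> 2) at_top
       \<and> ((\<lambda>y. dcap (B y) / (2 / y\<^sup>2 * hcap A)) \<longlongrightarrow> 1) at_top"
proof
  \<comment> \<open>Strict positivity permits cancelling \<open>hcap A\<close>; with capacity 0 the
    quotients would be 0 by the convention for division.\<close>
  have pos: "0 < hcap A"
    using mapping_out_expansion[OF assms(1,2)] by metis
  have "((\<lambda>y. y\<^sup>2 * dcap (cayley y ` A) / hcap A) \<longlongrightarrow> 2 * hcap A / hcap A) at_top"
    by (intro tendsto_intros dcap_cayley_asymptotics assms) (use pos in simp)
  then have "((\<lambda>y. y\<^sup>2 * dcap (cayley y ` A) / hcap A) \<longlongrightarrow> 2) at_top"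
    using pos by simp
  moreover have "\<forall>\<^sub>F y in at_top. y\<^sup>2 * dcap (cayley y ` A) / hcap A = y\<^sup>2 * dcap (B y) / hcap A"
    using eventually_gt_at_top[of 0] by eventually_elim (simp add: assms(3))
  ultimately show lim: "((\<lambda>y. y\<^sup>2 * dcap (B y) / hcap A) \<longlongrightarrow> 2) at_top"
    by (rule Lim_transform_eventually)
  have "((\<lambda>y. y\<^sup>2 * dcap (B y) / hcap A / 2) \<longlongrightarrow> 2 / 2) at_top"
    by (intro tendsto_intros lim) simp
  then have "((\<lambda>y. y\<^sup>2 * dcap (B y) / hcap A / 2) \<longlongrightarrow> 1) at_top" by simp
  moreover have "\<forall>\<^sub>F y in at_top. y\<^sup>2 * dcap (B y) / hcap A / 2 = dcap (B y) / (2 / y\<^sup>2 * hcap A)"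
    using eventually_gt_at_top[of 0] by eventually_elim (use pos in \<open>simp add: field_simps\<close>)
  ultimately show "((\<lambda>y. dcap (B y) / (2 / y\<^sup>2 * hcap A)) \<longlongrightarrow> 1) at_top"
    by (rule Lim_transform_eventually)
qed

end
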